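(* Let $S=(S(t))_{t\ge 0}$ be a convex $C_0$-semigroup on $X$ with generator $A$, monotone generator $A_\delta$ and Lipschitz set $D_L$. For every $x\in D_L$, one has: (i) $S(t)x\in D_L$ for all $t\in[0,\infty)$; (ii) for every $\mu\in M$ there is a locally bounded measurable function $f_\mu\colon[0,\infty)\to\mathbb{R}$ with $\mu S(t)x=\mu x+\int_0^t f_\mu(s)\,ds$ for all $t\ge 0$. For every $x\in D(A)$, it holds: (iii) $S(t)x\in D(A_\delta)$ for all $t\ge 0$, with $A_\delta S(t)x=S'_+(t,x)A_\delta x$; (iv) $\mu S(t)x=\mu x+\int_0^t \mu S'_+(s,x)A_\delta x\,ds$ for every $\mu\in M$ and all $t\ge 0$. In particular, $f_\mu(s)=\mu S'_+(s,x)A_\delta x$ for almost every $s\in[0,\infty)$, where $f_\mu$ is the function from (ii). Moreover, (iii) and (iv) hold for all $x\in D(A_\delta)$ if, in addition, the semigroup $S$ is monotone and continuous from above.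
   Context: Standing setting: $X$ is a real Banach lattice which is a Riesz subspace of a Dedekind $\sigma$-complete Riesz space $\overline X$. For a sequence $(x_n)_{n\in\mathbb{N}}$, write $x_n\downarrow x$ if $(x_n)$ is decreasing, bounded from below (by an element of $X$), and $x=\inf_n x_n\in\overline X$. Let $X_\delta:=\{x\in\overline X\colon x_n\downarrow x \text{ for some sequence }(x_n)_{n\in\mathbb{N}}\text{ in }X\}$. Let $M$ be the space of all positive linear functionals $\mu\colon X\to\mathbb{R}$ that are continuous from above, i.e. $\mu x_n\downarrow 0$ for every sequence $(x_n)$ in $X$ with $x_n\downarrow 0$. Every $\mu\in M$ has a unique extension $\mu\colon X_\delta\to\mathbb{R}$ which is continuous from above, i.e. $\mu x_n\downarrow\mu x$ for every sequence $(x_n)$ in $X_\delta$ with $x_n\downarrow x\in X_\delta$; this extension is again denoted $\mu$. It is assumed that $M$ separates the points of $X_\delta$. An operator $T\colon X\to X$ is convex if $T(\lambda x+(1-\lambda)y)\le\lambda Tx+(1-\lambda)Ty$ for all $x,y\in X$, $\lambda\in[0,1]$; monotone if $x\le y$ implies $Tx\le Ty$; bounded if $\sup_{\|x\|\le r}\|Tx\|<\infty$ for all $r>0$. A $C_0$-semigroup on $X$ is a family $S=(S(t))_{t\ge0}$ of bounded (possibly nonlinear) operators $X\to X$ with $S(0)x=x$, $S(t+s)x=S(t)S(s)x$ for all $s,t\ge 0$, and $S(t)x\to x$ in norm as $t\downarrow 0$, for all $x\in X$. It is convex (monotone) if each $S(t)$ is. A monotone $C_0$-semigroup is continuous from above if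 $S(t)x_n\downarrow S(t)0$ for all $t\ge0$ and every sequence $(x_n)$ in $X$ with $x_n\downarrow 0$; if it is also convex, each $S(t)$ has a unique convex monotone extension $S(t)\colon X_\delta\to X_\delta$ that is continuous from above ($S(t)x_n\downarrow S(t)x$ whenever $x_n\in X_\delta$, $x_n\downarrow x\in X_\delta$). Generator: $D(A)$ is the set of all $x\in X$ such that $\frac{S(h)x-x}{h}$ converges in norm in $X$ as $h\downarrow0$, and $Ax$ is the limit. Monotone generator: $D(A_\delta)$ is the set of all $x\in X$ such that for every sequence $(h_n)$ in $(0,\infty)$ with $h_n\downarrow0$ there exist a sequence $(A_nx)_{n\in\mathbb{N}}$ in $X$ and some $y\in X_\delta$ with $\big\|\frac{S(h_n)x-x}{h_n}-A_nx\big\|\to0$ and $A_nx\downarrow y$; then $y$ is uniquely determined and $A_\delta x:=y$. (For $x\in D(A)$ one has $x\in D(A_\delta)$ and $A_\delta x=Ax$.) Lipschitz set: $D_L:=\{x\in X\colon \sup_{h\in(0,h_0]}\|\frac{S(h)x-x}{h}\|<\infty\text{ for some }h_0>0\}$. Directional derivative: $S'_+(t,x)y:=\inf_{h>0}\frac{S(t)(x+hy)-S(t)x}{h}\in X_\delta$ (infimum in $\overline X$), for $x,y\in X$; if $S$ is monotone and continuous from above, the same formula defines it for $x\in X$, $y\in X_\delta$, using the extension of $S(t)$ to $X_\delta$. *)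

theory Defs
  imports
    "HOL-Analysis.Analysis"
    "HOL-Library.Lattice_Algebras"
    "HOL-Library.Lub_Glb"
begin

class riesz_space = ordered_real_vector + lattice_ab_group_add

class dedekind_sigma_complete_riesz_space = riesz_space +
  assumes sequence_has_sup:
    "(\<forall>n::nat. x n \<le> u) \<Longrightarrow> \<exists>s. (\<forall>n. x n \<le> s) \<and> (\<forall>v. (\<forall>n. x n \<le> v) \<longrightarrow> s \<le> v)"

class banach_lattice = riesz_space + lattice_ab_group_add_abs + banach +
  assumes norm_mono: "\<bar>x\<bar> \<le> \<bar>y\<bar> \<Longrightarrow> norm x \<le> norm y"

text \<open>
  The Banach lattice \<open>X\<close> is the type \<open>'a\<close> and the ambient space is the type \<open>'b\<close>; that \<open>X\<close> is a
  Riesz subspace is expressed by an injective lattice homomorphism \<open>j\<close>, so that \<open>range j\<close> is the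
  copy of \<open>X\<close> inside the ambient space. Suprema and infima of infinite sets in \<open>X\<close> need not be
  preserved by \<open>j\<close>.
\<close>

definition riesz_embedding :: "('a::riesz_space \<Rightarrow> 'b::riesz_space) \<Rightarrow> bool" where
  "riesz_embedding j \<longleftrightarrow> linear j \<and> inj j \<and>
     (\<forall>x y. j (sup x y) = sup (j x) (j y)) \<and> (\<forall>x y. j (inf x y) = inf (j x) (j y))"

definition decreases_to :: "('a \<Rightarrow> 'b::order) \<Rightarrow> (nat \<Rightarrow> 'b) \<Rightarrow> 'b \<Rightarrow> bool" where
  "decreases_to j x y \<longleftrightarrow>
     decseq x \<and> (\<exists>l. \<forall>n. j l \<le> x n) \<and> isGlb UNIV (range x) y"

definition real_decreases_to :: "(nat \<Rightarrow> real) \<Rightarrow> real \<Rightarrow> bool" where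
  "real_decreases_to a b \<longleftrightarrow> decseq a \<and> a \<longlonglongrightarrow> b"

definition X_delta :: "('a \<Rightarrow> 'b::order) \<Rightarrow> 'b set" where
  "X_delta j = {x. \<exists>u. decreases_to j (\<lambda>n. j (u n)) x}"

definition functionals_M :: "('a::banach_lattice \<Rightarrow> 'b::riesz_space) \<Rightarrow> ('a \<Rightarrow> real) set" where
  "functionals_M j = {\<mu>. linear \<mu> \<and> (\<forall>x\<ge>0. 0 \<le> \<mu> x) \<and>
     (\<forall>x. decreases_to j (\<lambda>n. j (x n)) 0 \<longrightarrow> real_decreases_to (\<lambda>n. \<mu> (x n)) 0)}"

text \<open>
  The extensions to \<open>X_delta j\<close> are unique only on that set; extensionality (value \<open>undefined\<close>
  elsewhere) makes the description by \<open>THE\<close> meaningful.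
\<close>

definition functional_ext :: "('a \<Rightarrow> 'b::order) \<Rightarrow> ('a \<Rightarrow> real) \<Rightarrow> 'b \<Rightarrow> real" where
  "functional_ext j \<mu> = (THE \<nu>. \<nu> \<in> extensional (X_delta j) \<and> (\<forall>x. \<nu> (j x) = \<mu> x) \<and>
     (\<forall>x y. (\<forall>n. x n \<in> X_delta j) \<and> y \<in> X_delta j \<and> decreases_to j x y \<longrightarrow>
        real_decreases_to (\<lambda>n. \<nu> (x n)) (\<nu> y)))"

definition M_separates_points :: "('a::banach_lattice \<Rightarrow> 'b::riesz_space) \<Rightarrow> bool" where
  "M_separates_points j \<longleftrightarrow> (\<forall>x\<in>X_delta j. \<forall>y\<in>X_delta j.
     x \<noteq> y \<longrightarrow> (\<exists>\<mu>\<in>functionals_M j. functional_ext j \<mu> x \<noteq> functional_ext j \<mu> y))"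

definition convex_operator_on :: "'a::ordered_real_vector set \<Rightarrow> ('a \<Rightarrow> 'a) \<Rightarrow> bool" where
  "convex_operator_on D T \<longleftrightarrow> (\<forall>x\<in>D. \<forall>y\<in>D. \<forall>c\<in>{0..1}.
     T (c *\<^sub>R x + (1 - c) *\<^sub>R y) \<le> c *\<^sub>R T x + (1 - c) *\<^sub>R T y)"

definition bounded_operator :: "('a::real_normed_vector \<Rightarrow> 'a) \<Rightarrow> bool" where
  "bounded_operator T \<longleftrightarrow> (\<forall>r>0. bounded (T ` {x. norm x \<le> r}))"

definition C0_semigroup :: "(real \<Rightarrow> 'a::real_normed_vector \<Rightarrow> 'a) \<Rightarrow> bool" where
  "C0_semigroup S \<longleftrightarrow>
     (\<forall>t\<ge>0. bounded_operator (S t)) \<and>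
     (\<forall>x. S 0 x = x) \<and>
     (\<forall>s\<ge>0. \<forall>t\<ge>0. \<forall>x. S (t + s) x = S t (S s x)) \<and>
     (\<forall>x. ((\<lambda>t. S t x) \<longlongrightarrow> x) (at_right 0))"

definition convex_semigroup :: "(real \<Rightarrow> 'a::ordered_real_vector \<Rightarrow> 'a) \<Rightarrow> bool" where
  "convex_semigroup S \<longleftrightarrow> (\<forall>t\<ge>0. convex_operator_on UNIV (S t))"

definition monotone_semigroup :: "(real \<Rightarrow> 'a::order \<Rightarrow> 'a) \<Rightarrow> bool" where
  "monotone_semigroup S \<longleftrightarrow> (\<forall>t\<ge>0. mono (S t))"

definition continuous_from_above ::
    "('a::zero \<Rightarrow> 'b::{order,zero}) \<Rightarrow> (real \<Rightarrow> 'a \<Rightarrow> 'a) \<Rightarrow> bool" where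
  "continuous_from_above j S \<longleftrightarrow> (\<forall>t\<ge>0. \<forall>x. decreases_to j (\<lambda>n. j (x n)) 0 \<longrightarrow>
     decreases_to j (\<lambda>n. j (S t (x n))) (j (S t 0)))"

definition operator_ext :: "('a \<Rightarrow> 'b::riesz_space) \<Rightarrow> ('a \<Rightarrow> 'a) \<Rightarrow> 'b \<Rightarrow> 'b" where
  "operator_ext j T = (THE U. U \<in> X_delta j \<rightarrow>\<^sub>E X_delta j \<and> (\<forall>x. U (j x) = j (T x)) \<and>
     convex_operator_on (X_delta j) U \<and> mono_on (X_delta j) U \<and>
     (\<forall>x y. (\<forall>n. x n \<in> X_delta j) \<and> y \<in> X_delta j \<and> decreases_to j x y \<longrightarrow>
        decreases_to j (\<lambda>n. U (x n)) (U y)))"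

text \<open>The operator \<open>T\<close> on \<open>X\<close>, read as an operator on the copy \<open>range j\<close> of \<open>X\<close>; it is meaningless
  outside of \<open>range j\<close>.\<close>

definition transported :: "('a \<Rightarrow> 'b) \<Rightarrow> ('a \<Rightarrow> 'a) \<Rightarrow> 'b \<Rightarrow> 'b" where
  "transported j T z = j (T (inv j z))"

definition difference_quotient ::
    "(real \<Rightarrow> 'a::real_vector \<Rightarrow> 'a) \<Rightarrow> 'a \<Rightarrow> real \<Rightarrow> 'a" where
  "difference_quotient S x h = (S h x - x) /\<^sub>R h"

definition generator_domain :: "(real \<Rightarrow> 'a::real_normed_vector \<Rightarrow> 'a) \<Rightarrow> 'a set" where
  "generator_domain S = {x. \<exists>y. (difference_quotient S x \<longlongrightarrow> y) (at_right 0)}"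

definition lipschitz_set :: "(real \<Rightarrow> 'a::real_normed_vector \<Rightarrow> 'a) \<Rightarrow> 'a set" where
  "lipschitz_set S = {x. \<exists>h\<^sub>0>0. bounded (difference_quotient S x ` {0<..h\<^sub>0})}"

definition null_sequence :: "(nat \<Rightarrow> real) \<Rightarrow> bool" where
  "null_sequence h \<longleftrightarrow> (\<forall>n. 0 < h n) \<and> real_decreases_to h 0"

definition monotone_limit_along ::
    "('a::banach_lattice \<Rightarrow> 'b::riesz_space) \<Rightarrow> (real \<Rightarrow> 'a \<Rightarrow> 'a) \<Rightarrow> 'a \<Rightarrow> (nat \<Rightarrow> real) \<Rightarrow> 'b \<Rightarrow> bool"
where
  "monotone_limit_along j S x h y \<longleftrightarrow> y \<in> X_delta j \<and>
     (\<exists>a. (\<lambda>n. norm (difference_quotient S x (h n) - a n)) \<longlonglongrightarrow> 0 \<and>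
        decreases_to j (\<lambda>n. j (a n)) y)"

definition monotone_generator_domain ::
    "('a::banach_lattice \<Rightarrow> 'b::riesz_space) \<Rightarrow> (real \<Rightarrow> 'a \<Rightarrow> 'a) \<Rightarrow> 'a set" where
  "monotone_generator_domain j S =
     {x. \<forall>h. null_sequence h \<longrightarrow> (\<exists>y. monotone_limit_along j S x h y)}"

definition monotone_generator ::
    "('a::banach_lattice \<Rightarrow> 'b::riesz_space) \<Rightarrow> (real \<Rightarrow> 'a \<Rightarrow> 'a) \<Rightarrow> 'a \<Rightarrow> 'b" where
  "monotone_generator j S x =
     (THE y. \<forall>h. null_sequence h \<longrightarrow> monotone_limit_along j S x h y)"

definition directional_derivative ::
    "('b::riesz_space \<Rightarrow> 'b) \<Rightarrow> 'b \<Rightarrow> 'b \<Rightarrow> 'b" where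
  "directional_derivative T x y =
     (THE z. isGlb UNIV ((\<lambda>h. (T (x + h *\<^sub>R y) - T x) /\<^sub>R h) ` {0<..}) z)"

definition is_density ::
    "(real \<Rightarrow> 'a \<Rightarrow> 'a) \<Rightarrow> ('a \<Rightarrow> real) \<Rightarrow> 'a \<Rightarrow> (real \<Rightarrow> real) \<Rightarrow> bool" where
  "is_density S \<mu> x f \<longleftrightarrow>
     set_borel_measurable borel {0..} f \<and> (\<forall>t\<ge>0. bounded (f ` {0..t})) \<and>
     (\<forall>t\<ge>0. \<mu> (S t x) = \<mu> x + (LBINT s:{0..t}. f s))"

text \<open>
  The two assertions about the orbit of \<open>x\<close> under the monotone generator. The argument \<open>E\<close> is the
  family of operators on the ambient space used in the directional derivative: either the
  transported family, which allows directions in \<open>X\<close>, or the family of extensions to \<open>X_delta j\<close>.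
\<close>

definition orbit_generator_formula ::
    "('a::banach_lattice \<Rightarrow> 'b::riesz_space) \<Rightarrow> (real \<Rightarrow> 'a \<Rightarrow> 'a) \<Rightarrow> (real \<Rightarrow> 'b \<Rightarrow> 'b) \<Rightarrow> 'a \<Rightarrow> bool"
where
  "orbit_generator_formula j S E x \<longleftrightarrow> (\<forall>t\<ge>0.
     S t x \<in> monotone_generator_domain j S \<and>
     monotone_generator j S (S t x) =
       directional_derivative (E t) (j x) (monotone_generator j S x))"

definition orbit_integral_formula ::
    "('a::banach_lattice \<Rightarrow> 'b::riesz_space) \<Rightarrow> (real \<Rightarrow> 'a \<Rightarrow> 'a) \<Rightarrow> (real \<Rightarrow> 'b \<Rightarrow> 'b) \<Rightarrow> 'a \<Rightarrow> bool"
where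
  "orbit_integral_formula j S E x \<longleftrightarrow> (\<forall>\<mu>\<in>functionals_M j.
     let g = (\<lambda>s. functional_ext j \<mu>
                (directional_derivative (E s) (j x) (monotone_generator j S x)))
     in (\<forall>t\<ge>0. set_integrable lborel {0..t} g \<and> \<mu> (S t x) = \<mu> x + (LBINT s:{0..t}. g s)) \<and>
        (\<exists>f. is_density S \<mu> x f) \<and>
        (\<forall>f. is_density S \<mu> x f \<longrightarrow> (AE s in lborel. 0 \<le> s \<longrightarrow> f s = g s)))"

end

theory Submission
  imports Defs
begin

text \<open>
  Convexity makes the quotients \<open>(S(t)(x + h y) - S(t)x) / h\<close> decrease as \<open>h\<close> decreases to \<open>0\<close>,
  so they decrease to the directional derivative. Convexity together with Baire's theorem makes
  \<open>S(t)\<close> Lipschitz near \<open>x\<close>, uniformly for \<open>t\<close> in bounded intervals; hence the difference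
  quotients \<open>(S(h)S(t)x - S(t)x) / h\<close> are asymptotically equal to those quotients with \<open>y\<close> replaced
  by (a decreasing approximation of) the generator at \<open>x\<close>. This is (iii). The same Lipschitz bound
  shows that \<open>t \<mapsto> \<mu> S(t)x\<close> is locally Lipschitz, which gives (i) and (ii); under (iii) this function
  has a right derivative everywhere, and dominated convergence applied to its difference quotients
  gives (iv).
\<close>

section \<open>Decreasing sequences and extensions that are continuous from above\<close>

text \<open>The limit objects are given by \<open>THE\<close>, so their existence and uniqueness
  must be proved before they can be used. One construction, \<open>mono_ext\<close>, serves
  functionals and operators alike: the value at y is an infimum along any sequence of X decreasing
  to y, and suprema with the members of a second sequence show that the choice does not matter. For
  the monotone generator the obstacle is that its domain allows a different limit for each null
  sequence; two null sequences are merged into one, and separation of points by M identifies the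
  limits. Convexity yields only order inequalities. They become norm bounds because an element
  between a and b has norm at most norm a + norm b, and positive functionals are norm continuous
  because X is complete, so a vanishing norm error is invisible to them. The same inequalities give
  the lower bounds inside X that convergence from above demands. The density in (ii) comes from
  Radon-Nikodym; the one in (iv) is a pointwise limit of quotients with steps 1/(n+1), hence
  measurable, and the two agree almost everywhere because their integrals over all [0,t]
  agree.\<close>

lemma isGlb_UNIV_iff:
  "isGlb UNIV A z \<longleftrightarrow> (\<forall>a\<in>A. z \<le> a) \<and> (\<forall>w. (\<forall>a\<in>A. w \<le> a) \<longrightarrow> w \<le> z)"
  by (auto simp: isGlb_def greatestP_def isLb_def setle_def setge_def)

lemma isGlb_UNIV_unique:
  fixes y z :: "'a::order"
  shows "isGlb UNIV A y \<Longrightarrow> isGlb UNIV A z \<Longrightarrow> y = z"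
  unfolding isGlb_UNIV_iff by (blast intro: order_antisym)

lemma isGlb_range_iff:
  "isGlb UNIV (range f) z \<longleftrightarrow> (\<forall>n. z \<le> f n) \<and> (\<forall>w. (\<forall>n. w \<le> f n) \<longrightarrow> w \<le> z)"
  by (auto simp: isGlb_UNIV_iff)

lemma decreases_to_iff:
  "decreases_to j x y \<longleftrightarrow> decseq x \<and> (\<exists>l. \<forall>n. j l \<le> x n) \<and> (\<forall>n. y \<le> x n) \<and>
     (\<forall>w. (\<forall>n. w \<le> x n) \<longrightarrow> w \<le> y)"
  by (simp add: decreases_to_def isGlb_range_iff)

lemma isGlb_exists_of_lower_bound:
  fixes x :: "nat \<Rightarrow> 'b::dedekind_sigma_complete_riesz_space"
  assumes "\<And>n. l \<le> x n"
  shows "\<exists>z. isGlb UNIV (range x) z"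
proof -
  have "\<forall>n. - x n \<le> - l" using assms by simp
  then obtain s where s: "\<forall>n. - x n \<le> s" "\<forall>v. (\<forall>n. - x n \<le> v) \<longrightarrow> s \<le> v"
    using sequence_has_sup[of "\<lambda>n. - x n"] by blast
  have "isGlb UNIV (range x) (- s)"
    unfolding isGlb_range_iff
  proof (intro conjI allI impI)
    show "- s \<le> x n" for n using s(1) minus_le_iff by blast
    fix w assume "\<forall>n. w \<le> x n"
    then have "s \<le> - w" using s(2) by simp
    then show "w \<le> - s" using le_minus_iff by blast
  qed
  then show ?thesis ..
qed

text \<open>Sigma-completeness forces the Archimedean property: the multiples of v have an infimum s
  because u bounds them below, and s is unchanged by halving the multiples, so 2s is again a lower
  bound and s cannot be strictly positive.\<close>

lemma archimedean_le:
  fixes u v :: "'b::dedekind_sigma_complete_riesz_space"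
  assumes "\<And>n::nat. u \<le> (1 / real (Suc n)) *\<^sub>R v"
  shows "u \<le> 0"
proof -
  obtain s where s: "isGlb UNIV (range (\<lambda>n. (1 / real (Suc n)) *\<^sub>R v)) s"
    using isGlb_exists_of_lower_bound[of u "\<lambda>n. (1 / real (Suc n)) *\<^sub>R v", OF assms] by blast
  have "2 *\<^sub>R s \<le> (1 / real (Suc n)) *\<^sub>R v" for n
  proof -
    \<comment> \<open>The index is chosen so that its successor is 2(n+1); doubling then gives
      exactly the n-th multiple.\<close>
    have "s \<le> (1 / real (Suc (2 * n + 1))) *\<^sub>R v"
      using s unfolding isGlb_range_iff by blast
    then have "2 *\<^sub>R s \<le> 2 *\<^sub>R ((1 / real (Suc (2 * n + 1))) *\<^sub>R v)"
      by (rule scaleR_left_mono) simp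
    also have "\<dots> = (1 / real (Suc n)) *\<^sub>R v"
      by (simp add: field_simps)
    finally show ?thesis .
  qed
  then have "2 *\<^sub>R s \<le> s" using s unfolding isGlb_range_iff by blast
  then have "s \<le> 0" by (simp add: scaleR_2)
  moreover have "u \<le> s" using s assms unfolding isGlb_range_iff by blast
  ultimately show ?thesis by order
qed

lemma archimedean_le_interval:
  fixes u v w :: "'b::dedekind_sigma_complete_riesz_space"
  assumes "\<And>e. 0 < e \<Longrightarrow> e \<le> 1 \<Longrightarrow> u \<le> w + e *\<^sub>R v"
  shows "u \<le> w"
proof -
  have "u - w \<le> (1 / real (Suc n)) *\<^sub>R v" for n
    using assms[of "1 / real (Suc n)"] by (simp add: diff_le_eq add.commute)
  then have "u - w \<le> 0" by (rule archimedean_le)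
  then show ?thesis by simp
qed

section \<open>Decreasing sequences along the embedding, and extension of monotone maps\<close>

locale riesz_pair =
  fixes j :: "'a::riesz_space \<Rightarrow> 'b::dedekind_sigma_complete_riesz_space"
  assumes emb: "riesz_embedding j"
begin

lemma lin: "linear j"
  using emb by (simp add: riesz_embedding_def)

lemmas j_simps = linear_add[OF lin] linear_diff[OF lin] linear_scale[OF lin] linear_0[OF lin]
  linear_neg[OF lin]

lemma j_inf: "j (inf x y) = inf (j x) (j y)" and j_sup: "j (sup x y) = sup (j x) (j y)"
  using emb by (simp_all add: riesz_embedding_def)

lemma j_eq_iff: "j x = j y \<longleftrightarrow> x = y"
  using emb by (auto simp: riesz_embedding_def inj_def)

lemma j_le_iff: "j x \<le> j y \<longleftrightarrow> x \<le> y"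
  by (metis j_inf j_eq_iff inf.absorb_iff1)

lemma decseq_j_iff: "decseq (\<lambda>n. j (u n)) \<longleftrightarrow> decseq u"
  by (simp add: decseq_def j_le_iff)

lemma decreases_to_X_deltaI: "decreases_to j (\<lambda>n. j (u n)) x \<Longrightarrow> x \<in> X_delta j"
  unfolding X_delta_def by blast

lemma decreases_to_const: "decreases_to j (\<lambda>n. j x) (j x)"
  by (auto simp: decreases_to_iff decseq_def)

lemma j_in_X_delta: "j x \<in> X_delta j"
  using decreases_to_const by (rule decreases_to_X_deltaI)

lemma decreases_to_exists:
  assumes "decseq u" "\<And>n. l \<le> u n"
  shows "\<exists>y\<in>X_delta j. decreases_to j (\<lambda>n. j (u n)) y"
proof -
  obtain z where "isGlb UNIV (range (\<lambda>n. j (u n))) z"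
    using isGlb_exists_of_lower_bound[of "j l" "\<lambda>n. j (u n)"] assms(2) j_le_iff by blast
  then have "decreases_to j (\<lambda>n. j (u n)) z"
    using assms by (auto simp: decreases_to_def decseq_j_iff j_le_iff)
  then show ?thesis using decreases_to_X_deltaI by blast
qed

lemma decreases_to_add:
  assumes "decreases_to j x y" "decreases_to j x' y'"
  shows "decreases_to j (\<lambda>n. x n + x' n) (y + y')"
proof -
  have d: "decseq x" "decseq x'" using assms by (auto simp: decreases_to_iff)
  obtain l l' where l: "\<And>n. j l \<le> x n" "\<And>n. j l' \<le> x' n"
    using assms by (auto simp: decreases_to_iff)
  have "w \<le> y + y'" if w: "\<forall>n. w \<le> x n + x' n" for w
  proof -
    \<comment> \<open>Decoupling the two indices allows the infima to be taken one after the
      other.\<close>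
    have "w \<le> x n + x' m" for n m
    proof -
      have "w \<le> x (max n m) + x' (max n m)" using w by blast
      also have "\<dots> \<le> x n + x' m" using d by (intro add_mono) (auto simp: decseq_def)
      finally show ?thesis .
    qed
    then have "w - x' m \<le> x n" for n m by (simp add: diff_le_eq)
    then have "w - x' m \<le> y" for m using assms(1) by (auto simp: decreases_to_iff)
    then have "w - y \<le> x' m" for m by (simp add: diff_le_eq add.commute)
    then have "w - y \<le> y'" using assms(2) by (auto simp: decreases_to_iff)
    then show ?thesis by (simp add: diff_le_eq add.commute)
  qed
  moreover have "\<forall>n. j (l + l') \<le> x n + x' n" using l by (simp add: j_simps add_mono)
  ultimately show ?thesis using assms d
    unfolding decreases_to_iff by (auto simp: decseq_def intro!: add_mono exI[of _ "l + l'"])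
qed

lemma decreases_to_scaleR:
  assumes "decreases_to j x y" "0 \<le> c"
  shows "decreases_to j (\<lambda>n. c *\<^sub>R x n) (c *\<^sub>R y)"
proof (cases "c = 0")
  case True
  then show ?thesis using decreases_to_const[of 0] by (simp add: j_simps)
next
  case False
  then have c: "c > 0" using assms by simp
  obtain l where l: "\<And>n. j l \<le> x n" using assms by (auto simp: decreases_to_iff)
  have "w \<le> c *\<^sub>R y" if w: "\<forall>n. w \<le> c *\<^sub>R x n" for w
  proof -
    have "\<forall>n. w /\<^sub>R c \<le> x n" using w pos_divideR_le_eq[OF c] by blast
    then have "w /\<^sub>R c \<le> y" using assms(1) by (simp add: decreases_to_iff)
    then show ?thesis using pos_divideR_le_eq[OF c] by blast
  qed
  then show ?thesis using assms l
    unfolding decreases_to_iff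
    by (auto simp: decseq_def intro!: scaleR_left_mono exI[of _ "c *\<^sub>R l"] simp: j_simps)
qed

text \<open>Raising y to \<open>x n\<close> raises the supremum with b by at most
  \<open>x n - y\<close>, by translation invariance of \<open>sup\<close>. Hence the infimum passes
  through \<open>sup\<close> for any b in the ambient space.\<close>

lemma decreases_to_sup:
  assumes "decreases_to j x y"
  shows "decreases_to j (\<lambda>n. sup (x n) b) (sup y b)"
proof -
  define s where "s = sup y b"
  have "w \<le> s" if w: "\<forall>n. w \<le> sup (x n) b" for w
  proof -
    have "w - s + y \<le> x n" for n
    proof -
      have "y \<le> x n" using assms by (simp add: decreases_to_iff)
      then have "sup (x n) b \<le> sup (y + (x n - y)) (b + (x n - y))"
        by (intro sup_mono) auto
      also have "\<dots> = s + (x n - y)" by (simp only: add_sup_distrib_right s_def)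
      finally have "w \<le> s + (x n - y)" using w by (meson order_trans)
      then show ?thesis by (simp add: algebra_simps)
    qed
    then have "w - s + y \<le> y" using assms unfolding decreases_to_iff by blast
    then show ?thesis by simp
  qed
  moreover obtain l where "\<And>n. j l \<le> x n" using assms by (auto simp: decreases_to_iff)
  then have "\<forall>n. j l \<le> sup (x n) b" by (simp add: le_supI1)
  ultimately show ?thesis using assms
    unfolding decreases_to_iff s_def by (auto simp: decseq_def intro: le_supI1 sup.mono)
qed

lemma j_Inf_fin:
  assumes "finite A" "A \<noteq> {}"
  shows "j (Inf_fin A) = Inf_fin (j ` A)"
  using assms by (induction rule: finite_ne_induct) (simp_all add: j_inf)

text \<open>Replaces a sequence in \<open>X_delta j\<close> by one from X with the same limit. The
  k-th term is the minimum of the k-th entries of rows 0 to k: including every earlier row makes it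
  decrease and drives it below each row, and excluding later rows keeps it above
  \<open>x k\<close>.\<close>

lemma diagonal_sequence:
  assumes x: "\<And>n. x n \<in> X_delta j" and dec: "decreases_to j x y"
  shows "\<exists>z. decreases_to j (\<lambda>n. j (z n)) y \<and> (\<forall>n. x n \<le> j (z n))"
proof -
  obtain u where u: "\<And>n. decreases_to j (\<lambda>k. j (u n k)) (x n)"
    using x unfolding X_delta_def by simp metis
  define z where "z k = Inf_fin ((\<lambda>n. u n k) ` {..k})" for k
  have z_le: "z k \<le> u n k" if "n \<le> k" for n k
    unfolding z_def using that by (intro Inf_fin.coboundedI) auto
  have jz: "j (z k) = Inf_fin ((\<lambda>n. j (u n k)) ` {..k})" for k
    unfolding z_def by (simp add: j_Inf_fin image_image)
  have d: "decseq x" using dec by (simp add: decreases_to_iff)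
  have x_le: "x k \<le> j (z k)" for k
    unfolding jz
  proof (intro Inf_fin.boundedI)
    fix a assume "a \<in> (\<lambda>n. j (u n k)) ` {..k}"
    then obtain n where n: "n \<le> k" "a = j (u n k)" by auto
    have "x k \<le> x n" using d n by (simp add: decseq_def)
    also have "\<dots> \<le> a" using u[of n] n by (simp add: decreases_to_iff)
    finally show "x k \<le> a" .
  qed auto
  have ud: "decseq (u n)" for n
    using u[of n] by (simp add: decreases_to_iff decseq_j_iff)
  have "z (Suc k) \<le> z k" for k
    unfolding z_def[of k]
  proof (intro Inf_fin.boundedI)
    fix a assume "a \<in> (\<lambda>n. u n k) ` {..k}"
    then obtain n where n: "n \<le> k" "a = u n k" by auto
    have "z (Suc k) \<le> u n (Suc k)" using n by (intro z_le) auto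
    also have "\<dots> \<le> a" using n ud[of n] by (simp add: decseq_SucD)
    finally show "z (Suc k) \<le> a" .
  qed auto
  then have zd: "decseq z" by (simp add: decseq_SucI)
  obtain l where l: "\<And>n. j l \<le> x n" using dec by (auto simp: decreases_to_iff)
  have lz: "j l \<le> j (z n)" for n using l x_le by (meson order_trans)
  have yz: "y \<le> j (z n)" for n
    using dec x_le by (meson decreases_to_iff order_trans)
  have "w \<le> y" if w: "\<forall>n. w \<le> j (z n)" for w
  proof -
    have "w \<le> j (u n k)" for n k
    proof -
      have "w \<le> j (z (max n k))" using w by blast
      also have "\<dots> \<le> j (u n (max n k))" by (simp add: j_le_iff z_le)
      also have "\<dots> \<le> j (u n k)" using ud[of n] by (simp add: j_le_iff decseq_def)
      finally show ?thesis .
    qed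
    then have "w \<le> x n" for n using u[of n] by (simp add: decreases_to_iff)
    then show ?thesis using dec by (simp add: decreases_to_iff)
  qed
  then have "decreases_to j (\<lambda>n. j (z n)) y"
    using zd lz yz by (auto simp: decreases_to_iff decseq_j_iff)
  then show ?thesis using x_le by blast
qed

lemma convex_combination_X_delta:
  assumes "x \<in> X_delta j" "y \<in> X_delta j" "0 \<le> c" "0 \<le> d"
  shows "c *\<^sub>R x + d *\<^sub>R y \<in> X_delta j"
proof -
  obtain u v where u: "decreases_to j (\<lambda>n. j (u n)) x" and v: "decreases_to j (\<lambda>n. j (v n)) y"
    using assms by (auto simp: X_delta_def)
  have "decreases_to j (\<lambda>n. c *\<^sub>R j (u n) + d *\<^sub>R j (v n)) (c *\<^sub>R x + d *\<^sub>R y)"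
    by (intro decreases_to_add decreases_to_scaleR u v assms)
  then show ?thesis by (intro decreases_to_X_deltaI[of "\<lambda>n. c *\<^sub>R u n + d *\<^sub>R v n"]) (simp add: j_simps)
qed

text \<open>The codomain is left general so that real functionals and operators into the ambient
  space are both instances. The description picks a unique z only for suitable F; see
  \<open>mono_ext_isGlb\<close>.\<close>

definition mono_ext :: "('a \<Rightarrow> 'c::order) \<Rightarrow> 'b \<Rightarrow> 'c" where
  "mono_ext F y = (THE z. \<exists>u. decreases_to j (\<lambda>n. j (u n)) y \<and> isGlb UNIV (range (\<lambda>n. F (u n))) z)"

text \<open>The last clause is separate because the existence of infima has a different source in
  each instance: completeness of the reals or sigma-completeness of the ambient space.\<close>

definition mono_continuous :: "('a \<Rightarrow> 'c::order) \<Rightarrow> bool" where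
  "mono_continuous F \<longleftrightarrow> (\<forall>x y. x \<le> y \<longrightarrow> F x \<le> F y) \<and>
     (\<forall>u x. decreases_to j (\<lambda>n. j (u n)) (j x) \<longrightarrow> isGlb UNIV (range (\<lambda>n. F (u n))) (F x)) \<and>
     (\<forall>u y. decreases_to j (\<lambda>n. j (u n)) y \<longrightarrow> (\<exists>z. isGlb UNIV (range (\<lambda>n. F (u n))) z))"

context
  fixes F :: "'a \<Rightarrow> 'c::order"
  assumes F: "mono_continuous F"
begin

lemma F_mono: "x \<le> y \<Longrightarrow> F x \<le> F y"
  and F_cont: "decreases_to j (\<lambda>n. j (u n)) (j x) \<Longrightarrow> isGlb UNIV (range (\<lambda>n. F (u n))) (F x)"
  and F_glb: "decreases_to j (\<lambda>n. j (u n)) b \<Longrightarrow> \<exists>z. isGlb UNIV (range (\<lambda>n. F (u n))) z"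
  using F unfolding mono_continuous_def by blast+

text \<open>Both well-definedness and monotonicity of the extension. Continuity of F is available
  only at limits in X; for fixed m the sequence \<open>sup (u n) (v m)\<close> has such a limit,
  namely \<open>v m\<close>, and its F-values stay above a.\<close>

lemma glb_image_mono:
  assumes "decreases_to j (\<lambda>n. j (u n)) x" "decreases_to j (\<lambda>n. j (v n)) y" "x \<le> y"
    and "isGlb UNIV (range (\<lambda>n. F (u n))) a" "isGlb UNIV (range (\<lambda>n. F (v n))) b"
  shows "a \<le> b"
proof -
  have "a \<le> F (v m)" for m
  proof -
    have "x \<le> j (v m)" using assms(2,3) by (meson decreases_to_iff order_trans)
    then have "decreases_to j (\<lambda>n. j (sup (u n) (v m))) (j (v m))"
      using decreases_to_sup[OF assms(1), of "j (v m)"] by (simp add: j_sup sup_absorb2)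
    then have "isGlb UNIV (range (\<lambda>n. F (sup (u n) (v m)))) (F (v m))" by (rule F_cont)
    moreover have "a \<le> F (sup (u n) (v m))" for n
    proof -
      have "a \<le> F (u n)" using assms(4) by (simp add: isGlb_range_iff)
      also have "\<dots> \<le> F (sup (u n) (v m))" by (intro F_mono) simp
      finally show ?thesis .
    qed
    ultimately show ?thesis by (simp add: isGlb_range_iff)
  qed
  then show ?thesis using assms(5) by (simp add: isGlb_range_iff)
qed

lemma mono_ext_isGlb:
  assumes "decreases_to j (\<lambda>n. j (u n)) y"
  shows "isGlb UNIV (range (\<lambda>n. F (u n))) (mono_ext F y)"
proof -
  obtain z where z: "isGlb UNIV (range (\<lambda>n. F (u n))) z" using F_glb[OF assms] by blast
  have "mono_ext F y = z"
    unfolding mono_ext_def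
  proof (rule the_equality)
    show "\<exists>u. decreases_to j (\<lambda>n. j (u n)) y \<and> isGlb UNIV (range (\<lambda>n. F (u n))) z"
      using assms z by blast
    show "z' = z"
      if "\<exists>u. decreases_to j (\<lambda>n. j (u n)) y \<and> isGlb UNIV (range (\<lambda>n. F (u n))) z'" for z'
      using that glb_image_mono[OF _ assms order_refl _ z] glb_image_mono[OF assms _ order_refl z]
      by (blast intro: order_antisym)
  qed
  then show ?thesis using z by simp
qed

lemma mono_ext_embedding: "mono_ext F (j x) = F x"
  using mono_ext_isGlb[OF decreases_to_const] F_cont[OF decreases_to_const] by (rule isGlb_UNIV_unique)

lemma mono_ext_mono:
  assumes "x \<in> X_delta j" "y \<in> X_delta j" "x \<le> y"
  shows "mono_ext F x \<le> mono_ext F y"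
proof -
  obtain u v where u: "decreases_to j (\<lambda>n. j (u n)) x" and v: "decreases_to j (\<lambda>n. j (v n)) y"
    using assms(1,2) by (auto simp: X_delta_def)
  show ?thesis
    using glb_image_mono[OF u v assms(3) mono_ext_isGlb[OF u] mono_ext_isGlb[OF v]] .
qed

text \<open>A lower bound of all \<open>mono_ext F (x n)\<close> also bounds F along the diagonal
  sequence, which lies above x and has the same limit y.\<close>

lemma mono_ext_cont:
  assumes x: "\<And>n. x n \<in> X_delta j" and dec: "decreases_to j x y"
  shows "isGlb UNIV (range (\<lambda>n. mono_ext F (x n))) (mono_ext F y)"
proof -
  obtain z where z: "decreases_to j (\<lambda>n. j (z n)) y" "\<And>n. x n \<le> j (z n)"
    using diagonal_sequence[OF x dec] by blast
  have y: "y \<in> X_delta j" using z(1) by (rule decreases_to_X_deltaI)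
  have "w \<le> mono_ext F y" if w: "\<forall>n. w \<le> mono_ext F (x n)" for w
  proof -
    have "w \<le> F (z n)" for n
      using w mono_ext_mono[OF x j_in_X_delta z(2), of n] by (metis mono_ext_embedding order_trans)
    then show ?thesis using mono_ext_isGlb[OF z(1)] by (simp add: isGlb_range_iff)
  qed
  moreover have "mono_ext F y \<le> mono_ext F (x n)" for n
    using dec by (intro mono_ext_mono x y) (simp add: decreases_to_iff)
  ultimately show ?thesis by (auto simp: isGlb_range_iff)
qed

lemma ext_unique_on_X_delta:
  assumes "\<And>x. G (j x) = F x"
    and "\<And>x y. (\<And>n. x n \<in> X_delta j) \<Longrightarrow> y \<in> X_delta j \<Longrightarrow> decreases_to j x y \<Longrightarrow>
      isGlb UNIV (range (\<lambda>n. G (x n))) (G y)"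
    and "y \<in> X_delta j"
  shows "G y = mono_ext F y"
proof -
  obtain u where u: "decreases_to j (\<lambda>n. j (u n)) y" using assms(3) by (auto simp: X_delta_def)
  then have "isGlb UNIV (range (\<lambda>n. F (u n))) (G y)"
    using assms(2)[OF j_in_X_delta assms(3) u] assms(1) by simp
  then show ?thesis using mono_ext_isGlb[OF u] isGlb_UNIV_unique by blast
qed

end

end

lemma convex_operatorD:
  assumes "convex_operator_on UNIV T" "0 \<le> c" "c \<le> 1"
  shows "T (c *\<^sub>R x + (1 - c) *\<^sub>R y) \<le> c *\<^sub>R T x + (1 - c) *\<^sub>R T y"
  using assms by (simp add: convex_operator_on_def)

text \<open>Restates real convergence in terms of infima, so that functionals fit the
  order-theoretic extension scheme.\<close>

lemma real_decreases_to_iff: "real_decreases_to a b \<longleftrightarrow> decseq a \<and> isGlb UNIV (range a) b"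
proof
  assume "real_decreases_to a b"
  then have a: "decseq a" "a \<longlonglongrightarrow> b" by (auto simp: real_decreases_to_def)
  then show "decseq a \<and> isGlb UNIV (range a) b"
    by (auto simp: isGlb_range_iff decseq_ge intro: LIMSEQ_le_const)
next
  assume a: "decseq a \<and> isGlb UNIV (range a) b"
  then have bdd: "bdd_below (range a)" by (auto simp: isGlb_range_iff bdd_below_def)
  have "isGlb UNIV (range a) (Inf (range a))"
    using a by (intro isGlb_cInf) (auto simp: isGlb_range_iff setge_def)
  then have "b = Inf (range a)" using a isGlb_UNIV_unique by blast
  then show "real_decreases_to a b"
    using LIMSEQ_decseq_INF[OF bdd] a by (simp add: real_decreases_to_def)
qed

section \<open>Extensions of functionals and of convex monotone operators\<close>

locale banach_pair = riesz_pair j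
  for j :: "'a::banach_lattice \<Rightarrow> 'b::dedekind_sigma_complete_riesz_space"
begin

context
  fixes \<mu> :: "'a \<Rightarrow> real"
  assumes \<mu>: "\<mu> \<in> functionals_M j"
begin

lemma functional_linear: "linear \<mu>"
  using \<mu> by (simp add: functionals_M_def)

lemma functional_mono:
  assumes "x \<le> y" shows "\<mu> x \<le> \<mu> y"
proof -
  have "0 \<le> \<mu> (y - x)" using \<mu> assms by (simp add: functionals_M_def)
  then show ?thesis by (simp add: linear_diff[OF functional_linear])
qed

lemma functional_isGlb:
  assumes "decreases_to j (\<lambda>n. j (u n)) (j x)"
  shows "isGlb UNIV (range (\<lambda>n. \<mu> (u n))) (\<mu> x)"
proof -
  have "decreases_to j (\<lambda>n. j (u n - x)) 0"
    using decreases_to_add[OF assms decreases_to_const[of "- x"]] by (simp add: j_simps)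
  then have "(\<lambda>n. \<mu> (u n - x)) \<longlonglongrightarrow> 0"
    using \<mu> by (simp add: functionals_M_def real_decreases_to_def)
  then have "(\<lambda>n. \<mu> (u n)) \<longlonglongrightarrow> \<mu> x"
    by (simp add: linear_diff[OF functional_linear] LIM_zero_iff)
  moreover have "decseq (\<lambda>n. \<mu> (u n))"
    using assms by (simp add: decreases_to_iff decseq_def functional_mono j_le_iff)
  ultimately have "real_decreases_to (\<lambda>n. \<mu> (u n)) (\<mu> x)" by (simp add: real_decreases_to_def)
  then show ?thesis by (simp add: real_decreases_to_iff)
qed

lemma functional_glb_exists:
  assumes "decreases_to j (\<lambda>n. j (u n)) y"
  shows "\<exists>z. isGlb UNIV (range (\<lambda>n. \<mu> (u n))) z"
proof -
  obtain l where "\<And>n. l \<le> u n" using assms by (auto simp: decreases_to_iff j_le_iff)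
  then have "\<mu> l <=* range (\<lambda>n. \<mu> (u n))" by (auto simp: setge_def functional_mono)
  then have "isGlb UNIV (range (\<lambda>n. \<mu> (u n))) (Inf (range (\<lambda>n. \<mu> (u n))))"
    by (intro isGlb_cInf) auto
  then show ?thesis ..
qed

lemma mono_continuous_functional: "mono_continuous \<mu>"
  using functional_mono functional_isGlb functional_glb_exists by (simp add: mono_continuous_def)

text \<open>Justifies the \<open>THE\<close>: \<open>mono_ext\<close> has the required properties,
  and \<open>ext_unique_on_X_delta\<close> excludes any other choice on \<open>X_delta j\<close>.
  The restriction supplies extensionality.\<close>

lemma functional_ext_eq: "functional_ext j \<mu> = restrict (mono_ext \<mu>) (X_delta j)"
  unfolding functional_ext_def
proof (rule the_equality, intro conjI allI impI)
  show "restrict (mono_ext \<mu>) (X_delta j) \<in> extensional (X_delta j)" by simp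
  show "restrict (mono_ext \<mu>) (X_delta j) (j x) = \<mu> x" for x
    using mono_ext_embedding[OF mono_continuous_functional] by (simp add: j_in_X_delta)
  fix x y assume xy: "(\<forall>n. x n \<in> X_delta j) \<and> y \<in> X_delta j \<and> decreases_to j x y"
  then have "isGlb UNIV (range (\<lambda>n. mono_ext \<mu> (x n))) (mono_ext \<mu> y)"
    using mono_ext_cont[OF mono_continuous_functional] by blast
  moreover have "decseq (\<lambda>n. mono_ext \<mu> (x n))"
    using xy mono_ext_mono[OF mono_continuous_functional] by (auto simp: decseq_def decreases_to_iff)
  ultimately show "real_decreases_to (\<lambda>n. restrict (mono_ext \<mu>) (X_delta j) (x n))
      (restrict (mono_ext \<mu>) (X_delta j) y)"
    using xy by (simp add: real_decreases_to_iff)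
next
  fix \<nu> assume \<nu>: "\<nu> \<in> extensional (X_delta j) \<and> (\<forall>x. \<nu> (j x) = \<mu> x) \<and>
    (\<forall>x y. (\<forall>n. x n \<in> X_delta j) \<and> y \<in> X_delta j \<and> decreases_to j x y \<longrightarrow>
        real_decreases_to (\<lambda>n. \<nu> (x n)) (\<nu> y))"
  have "\<nu> y = mono_ext \<mu> y" if "y \<in> X_delta j" for y
    using \<nu> by (intro ext_unique_on_X_delta[OF mono_continuous_functional _ _ that])
      (auto simp: real_decreases_to_iff)
  then show "\<nu> = restrict (mono_ext \<mu>) (X_delta j)"
    using \<nu> by (intro extensionalityI[of _ "X_delta j"]) auto
qed

lemma functional_ext_tendsto:
  assumes "decreases_to j (\<lambda>n. j (u n)) y"
  shows "(\<lambda>n. \<mu> (u n)) \<longlonglongrightarrow> functional_ext j \<mu> y"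
proof -
  have "isGlb UNIV (range (\<lambda>n. \<mu> (u n))) (mono_ext \<mu> y)"
    using mono_ext_isGlb[OF mono_continuous_functional assms] .
  moreover have "decseq (\<lambda>n. \<mu> (u n))"
    using assms by (simp add: decreases_to_iff decseq_def functional_mono j_le_iff)
  ultimately have "real_decreases_to (\<lambda>n. \<mu> (u n)) (mono_ext \<mu> y)"
    by (simp add: real_decreases_to_iff)
  then show ?thesis
    using decreases_to_X_deltaI[OF assms] by (simp add: real_decreases_to_def functional_ext_eq)
qed

end

context
  fixes T :: "'a \<Rightarrow> 'a"
  assumes T_convex: "convex_operator_on UNIV T"
    and T_mono: "mono T"
    and T_zero: "\<And>x. decreases_to j (\<lambda>n. j (x n)) 0 \<Longrightarrow> decreases_to j (\<lambda>n. j (T (x n))) (j (T 0))"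
begin

text \<open>Continuity from above at \<open>0\<close> transfers to \<open>y\<close> by writing \<open>u n\<close> as a convex combination of
  \<open>(1 + e) y\<close> and a multiple of \<open>u n - y\<close>.\<close>

lemma operator_isGlb:
  assumes u: "decreases_to j (\<lambda>n. j (u n)) (j y)"
  shows "isGlb UNIV (range (\<lambda>n. j (T (u n)))) (j (T y))"
proof -
  have "w \<le> j (T y)" if w: "\<forall>n. w \<le> j (T (u n))" for w
  proof (rule archimedean_le_interval)
    fix e :: real assume e: "0 < e" "e \<le> 1"
    \<comment> \<open>The factor is the one for which \<open>u n\<close> is the combination of
      (1+e)y and \<open>v n\<close> with weights 1/(1+e) and e/(1+e). It does not depend on n, so
      \<open>v\<close> still decreases to 0.\<close>
    define v where "v n = ((1 + e) / e) *\<^sub>R (u n - y)" for n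
    have "decreases_to j (\<lambda>n. ((1 + e) / e) *\<^sub>R (j (u n) + j (- y))) (((1 + e) / e) *\<^sub>R (j y + j (- y)))"
      using e by (intro decreases_to_scaleR decreases_to_add u decreases_to_const) auto
    then have "decreases_to j (\<lambda>n. j (v n)) 0"
      by (simp add: v_def j_simps)
    then have Tv: "decreases_to j (\<lambda>n. j (T (v n))) (j (T 0))" by (rule T_zero)
    \<comment> \<open>The convexity bound for T at (1+e)y, a point between y and 2y. It tends to T y
      as e tends to 0, so the overshoot past y costs nothing in the limit.\<close>
    define p where "p = (1 - e) *\<^sub>R T y + e *\<^sub>R T (2 *\<^sub>R y)"
    have Tu: "(1 + e) *\<^sub>R T (u n) \<le> p + e *\<^sub>R T (v n)" for n
    proof -
      have "(1 - e) *\<^sub>R y + (1 - (1 - e)) *\<^sub>R (2 *\<^sub>R y) = (1 + e) *\<^sub>R y"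
        using scaleR_add_left[of "1 - e" "2 * e" y] by (simp add: mult.commute add.commute)
      moreover have "T ((1 - e) *\<^sub>R y + (1 - (1 - e)) *\<^sub>R (2 *\<^sub>R y))
          \<le> (1 - e) *\<^sub>R T y + (1 - (1 - e)) *\<^sub>R T (2 *\<^sub>R y)"
        using e by (intro convex_operatorD T_convex) auto
      ultimately have 1: "T ((1 + e) *\<^sub>R y) \<le> p" by (simp add: p_def)
      have ee: "0 < e + e * e" using e by (simp add: add_pos_pos)
      define c where "c = 1 / (1 + e)"
      have c: "c \<in> {0..1}" "c * (1 + e) = 1" "(1 + e) * (1 - c) = e" "(1 - c) * ((1 + e) / e) = 1"
        using e ee by (auto simp: c_def field_simps)
      have "c *\<^sub>R ((1 + e) *\<^sub>R y) + (1 - c) *\<^sub>R v n = u n"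
        using c by (simp add: v_def)
      moreover have "T (c *\<^sub>R ((1 + e) *\<^sub>R y) + (1 - c) *\<^sub>R v n)
          \<le> c *\<^sub>R T ((1 + e) *\<^sub>R y) + (1 - c) *\<^sub>R T (v n)"
        using c by (intro convex_operatorD T_convex) auto
      ultimately have "T (u n) \<le> c *\<^sub>R T ((1 + e) *\<^sub>R y) + (1 - c) *\<^sub>R T (v n)" by simp
      then have "(1 + e) *\<^sub>R T (u n) \<le> (1 + e) *\<^sub>R (c *\<^sub>R T ((1 + e) *\<^sub>R y) + (1 - c) *\<^sub>R T (v n))"
        using e by (intro scaleR_left_mono) auto
      also have "\<dots> = T ((1 + e) *\<^sub>R y) + e *\<^sub>R T (v n)"
        using c by (simp add: scaleR_add_right mult.commute)
      also have "\<dots> \<le> p + e *\<^sub>R T (v n)" using 1 by simp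
      finally show ?thesis .
    qed
    have "((1 + e) *\<^sub>R w - j p) /\<^sub>R e \<le> j (T (v n))" for n
    proof -
      have "(1 + e) *\<^sub>R w \<le> (1 + e) *\<^sub>R j (T (u n))" using w e by (intro scaleR_left_mono) auto
      also have "\<dots> \<le> j p + e *\<^sub>R j (T (v n))" using Tu[of n] j_le_iff by (simp flip: j_simps)
      finally have "(1 + e) *\<^sub>R w - j p \<le> e *\<^sub>R j (T (v n))" by (simp add: diff_le_eq add.commute)
      then show ?thesis using pos_divideR_le_eq[OF e(1)] by blast
    qed
    then have "((1 + e) *\<^sub>R w - j p) /\<^sub>R e \<le> j (T 0)" using Tv unfolding decreases_to_iff by blast
    then have "(1 + e) *\<^sub>R w - j p \<le> e *\<^sub>R j (T 0)" using pos_divideR_le_eq[OF e(1)] by blast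
    \<comment> \<open>The coefficient of e is a fixed element of the ambient space, free of n and e,
      as \<open>archimedean_le_interval\<close> requires; w itself occurs in it.\<close>
    then show "w \<le> j (T y) + e *\<^sub>R (j (T (2 *\<^sub>R y)) + j (T 0) - j (T y) - w)"
      by (simp add: p_def j_simps algebra_simps)
  qed
  moreover have "j (T y) \<le> j (T (u n))" for n
    using u T_mono by (simp add: decreases_to_iff j_le_iff mono_def)
  ultimately show ?thesis by (auto simp: isGlb_range_iff)
qed

lemma operator_lower_bound:
  assumes "decreases_to j (\<lambda>n. j (u n)) y"
  shows "\<exists>l. \<forall>n. j (T l) \<le> j (T (u n))"
  using assms T_mono by (auto simp: decreases_to_iff j_le_iff mono_def)

lemma operator_mono: "x \<le> y \<Longrightarrow> j (T x) \<le> j (T y)"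
  using T_mono by (simp add: j_le_iff mono_def)

lemma operator_glb_exists:
  assumes "decreases_to j (\<lambda>n. j (u n)) y"
  shows "\<exists>z. isGlb UNIV (range (\<lambda>n. j (T (u n)))) z"
  using operator_lower_bound[OF assms] isGlb_exists_of_lower_bound by metis

lemma mono_continuous_operator: "mono_continuous (\<lambda>x. j (T x))"
  using operator_mono operator_isGlb operator_glb_exists by (simp add: mono_continuous_def)

abbreviation (input) "T_ext \<equiv> mono_ext (\<lambda>x. j (T x))"

lemma T_ext_decreases:
  assumes "decreases_to j (\<lambda>n. j (u n)) y"
  shows "decreases_to j (\<lambda>n. j (T (u n))) (T_ext y)"
proof -
  have "isGlb UNIV (range (\<lambda>n. j (T (u n)))) (T_ext y)"
    using mono_ext_isGlb[OF mono_continuous_operator assms] .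
  moreover have "decseq (\<lambda>n. j (T (u n)))"
    using assms T_mono by (simp add: decreases_to_iff decseq_def j_le_iff mono_def)
  ultimately show ?thesis
    using operator_lower_bound[OF assms] by (auto simp: decreases_to_def)
qed

text \<open>The left side lies below every member of a decreasing sequence whose infimum is the
  right side; nonnegative coefficients allow infima to be combined.\<close>

lemma T_ext_convex: "convex_operator_on (X_delta j) T_ext"
  unfolding convex_operator_on_def
proof (intro ballI)
  fix x y and c :: real assume x: "x \<in> X_delta j" and y: "y \<in> X_delta j" and c: "c \<in> {0..1}"
  obtain u v where u: "decreases_to j (\<lambda>n. j (u n)) x" and v: "decreases_to j (\<lambda>n. j (v n)) y"
    using x y by (auto simp: X_delta_def)
  have c': "0 \<le> c" "0 \<le> 1 - c" using c by auto
  have "decreases_to j (\<lambda>n. c *\<^sub>R j (u n) + (1 - c) *\<^sub>R j (v n)) (c *\<^sub>R x + (1 - c) *\<^sub>R y)"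
    by (intro decreases_to_add decreases_to_scaleR u v c')
  then have "decreases_to j (\<lambda>n. j (c *\<^sub>R u n + (1 - c) *\<^sub>R v n)) (c *\<^sub>R x + (1 - c) *\<^sub>R y)"
    by (simp add: j_simps)
  from T_ext_decreases[OF this]
  have le: "T_ext (c *\<^sub>R x + (1 - c) *\<^sub>R y) \<le> j (T (c *\<^sub>R u n + (1 - c) *\<^sub>R v n))" for n
    by (simp add: decreases_to_iff)
  have "T_ext (c *\<^sub>R x + (1 - c) *\<^sub>R y) \<le> c *\<^sub>R j (T (u n)) + (1 - c) *\<^sub>R j (T (v n))" for n
  proof -
    have "T (c *\<^sub>R u n + (1 - c) *\<^sub>R v n) \<le> c *\<^sub>R T (u n) + (1 - c) *\<^sub>R T (v n)"
      using c' by (intro convex_operatorD T_convex) auto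
    then have "j (T (c *\<^sub>R u n + (1 - c) *\<^sub>R v n)) \<le> j (c *\<^sub>R T (u n) + (1 - c) *\<^sub>R T (v n))"
      by (simp only: j_le_iff)
    also have "\<dots> = c *\<^sub>R j (T (u n)) + (1 - c) *\<^sub>R j (T (v n))" by (simp only: j_simps)
    finally show ?thesis using le[of n] by order
  qed
  moreover have "decreases_to j (\<lambda>n. c *\<^sub>R j (T (u n)) + (1 - c) *\<^sub>R j (T (v n)))
      (c *\<^sub>R T_ext x + (1 - c) *\<^sub>R T_ext y)"
    by (intro decreases_to_add decreases_to_scaleR T_ext_decreases u v c')
  ultimately show "T_ext (c *\<^sub>R x + (1 - c) *\<^sub>R y) \<le> c *\<^sub>R T_ext x + (1 - c) *\<^sub>R T_ext y"
    unfolding decreases_to_iff by blast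
qed

lemma operator_ext_eq: "operator_ext j T = restrict T_ext (X_delta j)"
  unfolding operator_ext_def
proof (rule the_equality, intro conjI allI impI)
  let ?U = "restrict T_ext (X_delta j)"
  have "T_ext y \<in> X_delta j" if y: "y \<in> X_delta j" for y
  proof -
    obtain u where "decreases_to j (\<lambda>n. j (u n)) y" using y by (auto simp: X_delta_def)
    then show ?thesis using decreases_to_X_deltaI[OF T_ext_decreases] by simp
  qed
  then show "?U \<in> X_delta j \<rightarrow>\<^sub>E X_delta j" by auto
  show "?U (j x) = j (T x)" for x
    using mono_ext_embedding[OF mono_continuous_operator] by (simp add: j_in_X_delta)
  show "convex_operator_on (X_delta j) ?U"
    using T_ext_convex by (simp add: convex_operator_on_def convex_combination_X_delta)
  show "mono_on (X_delta j) ?U"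
    using mono_ext_mono[OF mono_continuous_operator] by (auto intro!: mono_onI)
  fix x y assume xy: "(\<forall>n. x n \<in> X_delta j) \<and> y \<in> X_delta j \<and> decreases_to j x y"
  then have "isGlb UNIV (range (\<lambda>n. T_ext (x n))) (T_ext y)"
    using mono_ext_cont[OF mono_continuous_operator] by blast
  moreover have "decseq (\<lambda>n. T_ext (x n))"
    using xy mono_ext_mono[OF mono_continuous_operator] by (auto simp: decseq_def decreases_to_iff)
  moreover obtain l where "\<And>n. j l \<le> x n" using xy by (auto simp: decreases_to_iff)
  then have "j (T l) \<le> T_ext (x n)" for n
    using xy mono_ext_mono[OF mono_continuous_operator j_in_X_delta, of "x n" l]
      mono_ext_embedding[OF mono_continuous_operator] by simp
  ultimately show "decreases_to j (\<lambda>n. ?U (x n)) (?U y)"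
    using xy by (auto simp: decreases_to_def)
next
  fix U assume U: "U \<in> X_delta j \<rightarrow>\<^sub>E X_delta j \<and> (\<forall>x. U (j x) = j (T x)) \<and>
     convex_operator_on (X_delta j) U \<and> mono_on (X_delta j) U \<and>
     (\<forall>x y. (\<forall>n. x n \<in> X_delta j) \<and> y \<in> X_delta j \<and> decreases_to j x y \<longrightarrow>
        decreases_to j (\<lambda>n. U (x n)) (U y))"
  have "U y = T_ext y" if "y \<in> X_delta j" for y
    using U by (intro ext_unique_on_X_delta[OF mono_continuous_operator _ _ that])
      (auto simp: decreases_to_def)
  then show "U = restrict T_ext (X_delta j)"
    using U by (intro extensionalityI[of _ "X_delta j"]) (auto simp: PiE_def)
qed

lemma operator_ext_embedding: "operator_ext j T (j x) = j (T x)"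
  using mono_ext_embedding[OF mono_continuous_operator] by (simp add: operator_ext_eq j_in_X_delta)

lemma operator_ext_decreases_to:
  assumes "decreases_to j (\<lambda>n. j (u n)) y"
  shows "decreases_to j (\<lambda>n. j (T (u n))) (operator_ext j T y)"
  using T_ext_decreases[OF assms] decreases_to_X_deltaI[OF assms] by (simp add: operator_ext_eq)

end

end

section \<open>Convex operators on Banach lattices\<close>

text \<open>The negative part of the limit is dominated by the distance from \<open>x n\<close> to
  a, because every \<open>x n\<close> is nonnegative.\<close>

lemma nonneg_limit:
  fixes a :: "'a::banach_lattice"
  assumes "x \<longlonglongrightarrow> a" "\<And>n. 0 \<le> x n"
  shows "0 \<le> a"
proof -
  have "norm (sup (- a) 0) \<le> norm (x n - a)" for n
  proof (rule norm_mono)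
    have "- a \<le> x n - a" using assms(2)[of n] by simp
    then have "sup (- a) 0 \<le> \<bar>x n - a\<bar>" by (meson abs_ge_self abs_ge_zero le_supI order_trans)
    then show "\<bar>sup (- a) 0\<bar> \<le> \<bar>x n - a\<bar>" by simp
  qed
  moreover have "(\<lambda>n. norm (x n - a)) \<longlonglongrightarrow> 0"
    using assms(1) by (simp add: LIM_zero tendsto_norm_zero)
  ultimately have "norm (sup (- a) 0) \<le> 0"
    by (meson LIMSEQ_le_const)
  then have "- a \<le> 0" by (metis norm_le_zero_iff sup.cobounded1)
  then show ?thesis by simp
qed

lemma norm_abs_lattice: "norm \<bar>x\<bar> = norm (x :: 'a::banach_lattice)"
  by (rule order_antisym) (simp_all add: norm_mono)

text \<open>The device by which two-sided convexity estimates become norm estimates: z is dominated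
  in absolute value by the sum of the absolute values of a and b.\<close>

lemma norm_between:
  fixes z :: "'a::banach_lattice"
  assumes "a \<le> z" "z \<le> b"
  shows "norm z \<le> norm a + norm b"
proof -
  have "z \<le> \<bar>b\<bar>" using assms abs_ge_self order_trans by blast
  moreover have "- z \<le> \<bar>a\<bar>" using assms abs_ge_minus_self order_trans neg_le_iff_le by metis
  ultimately have "z \<le> \<bar>a\<bar> + \<bar>b\<bar>" "- z \<le> \<bar>a\<bar> + \<bar>b\<bar>"
    by (simp_all add: add_increasing add_increasing2)
  then have "\<bar>z\<bar> \<le> \<bar>a\<bar> + \<bar>b\<bar>" by (rule abs_leI)
  also have "\<dots> = \<bar>\<bar>a\<bar> + \<bar>b\<bar>\<bar>" by simp
  finally have "norm z \<le> norm (\<bar>a\<bar> + \<bar>b\<bar>)" by (rule norm_mono)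
  also have "\<dots> \<le> norm a + norm b" using norm_triangle_ineq[of "\<bar>a\<bar>" "\<bar>b\<bar>"] by (simp add: norm_abs_lattice)
  finally show ?thesis .
qed

lemma nonneg_le_suminf:
  fixes y :: "nat \<Rightarrow> 'a::banach_lattice"
  assumes "summable y" "\<And>n. 0 \<le> y n"
  shows "y n \<le> suminf y"
proof -
  have "(\<lambda>m. sum y {..<m + Suc n} - y n) \<longlonglongrightarrow> suminf y - y n"
    using LIMSEQ_ignore_initial_segment[OF summable_LIMSEQ[OF assms(1)], of "Suc n"]
    by (intro tendsto_diff tendsto_const)
  moreover have "0 \<le> sum y {..<m + Suc n} - y n" for m
    using assms(2) sum_mono2[of "{..<m + Suc n}" "{n}" y] by simp
  ultimately have "0 \<le> suminf y - y n" by (rule nonneg_limit)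
  then show ?thesis by simp
qed

text \<open>If no bound existed, a convergent series of positive vectors could be built on whose
  terms mu grows without limit. Its sum dominates every term, so mu would be infinite there.\<close>

lemma positive_functional_bounded_linear:
  fixes \<mu> :: "'a::banach_lattice \<Rightarrow> real"
  assumes lin: "linear \<mu>" and pos: "\<And>x. 0 \<le> x \<Longrightarrow> 0 \<le> \<mu> x"
  shows "bounded_linear \<mu>"
proof (rule ccontr)
  assume "\<not> bounded_linear \<mu>"
  then have "\<forall>K. \<exists>x. \<not> norm (\<mu> x) \<le> norm x * K"
    using lin by (auto simp: bounded_linear_def bounded_linear_axioms_def)
  then have "\<forall>n. \<exists>x. norm x * 4 ^ n < \<bar>\<mu> x\<bar>" by (simp add: not_le)
  then obtain x where x: "\<And>n::nat. norm (x n) * 4 ^ n < \<bar>\<mu> (x n)\<bar>" by metis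
  have mono: "\<mu> a \<le> \<mu> b" if "a \<le> b" for a b
    using pos[of "b - a"] that by (simp add: linear_diff[OF lin])
  have x_pos: "0 < norm (x n)" for n
    using x[of n] by (cases "x n = 0") (auto simp: linear_0[OF lin])
  \<comment> \<open>Of the growth 4^n, a factor 2^n is spent on making the series summable; the
    other 2^n remains as a lower bound for mu.\<close>
  define y where "y n = (1 / (2 ^ n * norm (x n))) *\<^sub>R \<bar>x n\<bar>" for n
  have "norm (y n) = (1 / 2) ^ n" for n
    using x_pos[of n] by (simp add: y_def norm_abs_lattice power_one_over)
  then have "summable (\<lambda>n. norm (y n))" by (simp add: summable_geometric)
  then have "summable y" by (rule summable_norm_cancel)
  moreover have "0 \<le> y n" for n using x_pos[of n] by (simp add: y_def scaleR_nonneg_nonneg)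
  ultimately have y_le: "y n \<le> suminf y" for n by (rule nonneg_le_suminf)
  have "2 ^ n < \<mu> (suminf y)" for n
  proof -
    have "\<mu> (x n) \<le> \<mu> \<bar>x n\<bar>" "- \<mu> (x n) \<le> \<mu> \<bar>x n\<bar>"
      using mono[OF abs_ge_self] mono[OF abs_ge_minus_self[of "x n"]] by (simp_all add: linear_neg[OF lin])
    then have "norm (x n) * 4 ^ n < \<mu> \<bar>x n\<bar>" using x[of n] by linarith
    also have "\<dots> = (2 ^ n * norm (x n)) * \<mu> (y n)"
      using x_pos[of n] by (simp add: y_def linear_scale[OF lin])
    finally have "norm (x n) * (2 ^ n * 2 ^ n) < norm (x n) * (2 ^ n * \<mu> (y n))"
      by (simp add: mult_ac flip: power_mult_distrib)
    then have "2 ^ n < \<mu> (y n)" using x_pos[of n] by simp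
    also have "\<dots> \<le> \<mu> (suminf y)" using mono[OF y_le] .
    finally show ?thesis .
  qed
  moreover obtain n where "\<mu> (suminf y) < 2 ^ n" using real_arch_pow[of 2 "\<mu> (suminf y)"] by auto
  ultimately show False using order_less_asym by blast
qed

section \<open>Slope inequalities and norm estimates for convex operators\<close>

lemma convex_difference_le:
  assumes "convex_operator_on UNIV T" "0 \<le> c" "c \<le> 1"
  shows "T (x + c *\<^sub>R y) - T x \<le> c *\<^sub>R (T (x + y) - T x)"
proof -
  have "c *\<^sub>R (x + y) + (1 - c) *\<^sub>R x = x + c *\<^sub>R y" by (simp add: algebra_simps)
  then have "T (x + c *\<^sub>R y) \<le> c *\<^sub>R T (x + y) + (1 - c) *\<^sub>R T x"
    using convex_operatorD[OF assms, of "x + y" x] by simp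
  then show ?thesis by (simp add: algebra_simps)
qed

text \<open>x lies between x + cy and x - y, with weights 1/(1+c) and c/(1+c). No upper limit on c
  is needed, which later gives a bound uniform in the step.\<close>

lemma convex_difference_ge:
  assumes "convex_operator_on UNIV T" "0 \<le> c"
  shows "c *\<^sub>R (T x - T (x - y)) \<le> T (x + c *\<^sub>R y) - T x"
proof -
  define b where "b = 1 / (1 + c)"
  have b: "0 \<le> b" "b \<le> 1" "(1 + c) * b = 1" "(1 + c) * (1 - b) = c" "b * c = 1 - b"
    using assms(2) by (auto simp: b_def field_simps)
  have "b *\<^sub>R (x + c *\<^sub>R y) + (1 - b) *\<^sub>R (x - y) = x"
  proof -
    have "b *\<^sub>R (x + c *\<^sub>R y) + (1 - b) *\<^sub>R (x - y) = x + (b * c - (1 - b)) *\<^sub>R y"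
      by (simp add: algebra_simps)
    then show ?thesis using b(5) by simp
  qed
  then have "T x \<le> b *\<^sub>R T (x + c *\<^sub>R y) + (1 - b) *\<^sub>R T (x - y)"
    using convex_operatorD[OF assms(1) b(1,2), of "x + c *\<^sub>R y" "x - y"] by simp
  then have "(1 + c) *\<^sub>R T x \<le> (1 + c) *\<^sub>R (b *\<^sub>R T (x + c *\<^sub>R y) + (1 - b) *\<^sub>R T (x - y))"
    using assms(2) by (intro scaleR_left_mono) auto
  also have "\<dots> = T (x + c *\<^sub>R y) + c *\<^sub>R T (x - y)"
    using b(3,4) by (simp add: scaleR_add_right)
  finally show ?thesis by (simp add: algebra_simps)
qed

text \<open>Stretching y - x to length r gives z; the slope inequalities enclose T y - T x between
  d(T x - T(x-z)) and d(T(x+z) - T x). Each end has norm at most 2Kd, which produces the constant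
  4K/r.\<close>

lemma convex_lipschitz:
  fixes T :: "'a::banach_lattice \<Rightarrow> 'a"
  assumes T: "convex_operator_on UNIV T" and r: "0 < r"
    and K: "\<And>y. y \<in> cball x r \<Longrightarrow> norm (T y) \<le> K" and y: "y \<in> cball x r"
  shows "norm (T y - T x) \<le> 4 * K / r * norm (y - x)"
proof (cases "y = x")
  case False
  define d where "d = norm (y - x) / r"
  have d: "0 < d" "d \<le> 1" using False r y by (auto simp: d_def dist_norm norm_minus_commute)
  define z where "z = (y - x) /\<^sub>R d"
  have y_eq: "y = x + d *\<^sub>R z" using d by (simp add: z_def)
  have "norm z = r" using d False r by (simp add: z_def d_def)
  then have Kz: "norm (T (x + z)) \<le> K" "norm (T (x - z)) \<le> K" "norm (T x) \<le> K"
    using K r by (auto simp: dist_norm)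
  have "norm (T y - T x) \<le> norm (d *\<^sub>R (T x - T (x - z))) + norm (d *\<^sub>R (T (x + z) - T x))"
    unfolding y_eq using d by (intro norm_between convex_difference_ge convex_difference_le T) auto
  also have "\<dots> = d * norm (T x - T (x - z)) + d * norm (T (x + z) - T x)"
    using d by simp
  also have "\<dots> \<le> d * (K + K) + d * (K + K)"
    using d Kz by (intro add_mono mult_left_mono) (auto intro: norm_triangle_le_diff)
  finally show ?thesis by (simp add: d_def field_simps)
qed simp

lemma bounded_operatorD:
  assumes "bounded_operator T"
  obtains K where "\<And>y. norm y \<le> r \<Longrightarrow> norm (T y) \<le> K"
proof -
  have "bounded (T ` {y. norm y \<le> max r 1})"
    using assms unfolding bounded_operator_def by (meson less_max_iff_disj zero_less_one)
  then obtain K where "\<forall>z\<in>T ` {y. norm y \<le> max r 1}. norm z \<le> K" by (auto simp: bounded_iff)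
  then show ?thesis by (intro that[of K]) auto
qed

lemma convex_bounded_locally_lipschitz:
  fixes T :: "'a::banach_lattice \<Rightarrow> 'a"
  assumes "convex_operator_on UNIV T" "bounded_operator T"
  obtains L where "0 \<le> L"
    "\<And>y z. y \<in> cball x 1 \<Longrightarrow> z \<in> cball x 1 \<Longrightarrow> norm (T y - T z) \<le> L * norm (y - z)"
proof -
  obtain K where K: "\<And>y. norm y \<le> norm x + 3 \<Longrightarrow> norm (T y) \<le> K"
    using bounded_operatorD[OF assms(2), of "norm x + 3"] by blast
  \<comment> \<open>The centre is now z. Radius 2 about z covers the unit ball at x and stays within
    distance 3 of x, the origin of the bound on norms up to \<open>norm x + 3\<close>.\<close>
  have "norm (T y - T z) \<le> 4 * K / 2 * norm (y - z)" if y: "y \<in> cball x 1" and z: "z \<in> cball x 1" for y z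
  proof (rule convex_lipschitz[OF assms(1)])
    show "y \<in> cball z 2" using y z dist_triangle2[of z y x] by (simp add: dist_commute)
    fix w assume "w \<in> cball z 2"
    then have "dist x w \<le> 3" using z dist_triangle[of x w z] by simp
    then have "norm w \<le> norm x + 3" using norm_triangle_ineq2[of w x] by (simp add: dist_norm norm_minus_commute)
    then show "norm (T w) \<le> K" by (rule K)
  qed simp
  moreover have "0 \<le> 4 * K / 2" using K[of x] norm_ge_zero[of "T x"] by linarith
  ultimately show ?thesis using that[of "4 * K / 2"] by blast
qed

text \<open>Needed to make the sublevel sets in the Baire argument closed.\<close>

lemma convex_bounded_continuous:
  fixes T :: "'a::banach_lattice \<Rightarrow> 'a"
  assumes "convex_operator_on UNIV T" "bounded_operator T"
  shows "continuous_on UNIV T"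
proof -
  have "isCont T x" for x
  proof -
    obtain L where "\<And>y z. y \<in> cball x 1 \<Longrightarrow> z \<in> cball x 1 \<Longrightarrow> norm (T y - T z) \<le> L * norm (y - z)"
      using convex_bounded_locally_lipschitz[OF assms] by blast
    then have L: "\<And>y. y \<in> cball x 1 \<Longrightarrow> norm (T y - T x) \<le> L * norm (y - x)" by simp
    have "((\<lambda>y. T y - T x) \<longlongrightarrow> 0) (at x)"
    proof (rule Lim_null_comparison)
      have "\<forall>\<^sub>F y in at x. y \<in> cball x 1"
        by (intro eventually_at_in_open'[THEN eventually_mono, of "ball x 1"]) auto
      then show "\<forall>\<^sub>F y in at x. norm (T y - T x) \<le> L * norm (y - x)"
        by (rule eventually_mono) (rule L)
      show "((\<lambda>y. L * norm (y - x)) \<longlongrightarrow> 0) (at x)"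
        by (auto intro!: tendsto_eq_intros)
    qed
    then show ?thesis by (simp add: isCont_def LIM_zero_iff)
  qed
  then show ?thesis by (simp add: continuous_on_eq_continuous_at)
qed

text \<open>Baire's theorem yields a bound on some ball; convexity moves it to a ball around any point.\<close>

lemma convex_uniform_boundedness:
  fixes T :: "nat \<Rightarrow> 'a::banach_lattice \<Rightarrow> 'a"
  assumes T: "\<And>n. convex_operator_on UNIV (T n)" "\<And>n. bounded_operator (T n)"
    and ptw: "\<And>y. bounded (range (\<lambda>n. T n y))"
  shows "\<exists>r>0. \<exists>K. \<forall>n. \<forall>y\<in>cball x r. norm (T n y) \<le> K"
proof -
  define E where "E k = {y. \<forall>n. norm (T n y) \<le> real k}" for k :: nat
  have cl: "closed (E k)" for k
  proof -
    have "E k = (\<Inter>n. (\<lambda>y. norm (T n y)) -` {..real k})" by (auto simp: E_def)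
    then show ?thesis
      by (auto intro!: closed_INT closed_vimage continuous_on_norm convex_bounded_continuous T)
  qed
  have "\<exists>k. interior (E k) \<noteq> {}"
  proof (rule ccontr)
    assume "\<not> (\<exists>k. interior (E k) \<noteq> {})"
    then have "euclidean interior_of \<Union>(range E) = {}"
      using cl completely_metrizable_space_euclidean by (intro Baire_category_alt) auto
    moreover have "y \<in> \<Union>(range E)" for y
    proof -
      obtain B where "\<And>n. norm (T n y) \<le> B" using ptw[of y] by (auto simp: bounded_iff)
      moreover obtain k where "B \<le> real k" using real_arch_simple by blast
      ultimately have "y \<in> E k" by (auto simp: E_def intro: order_trans)
      then show ?thesis by blast
    qed
    then have "\<Union>(range E) = UNIV" by blast
    ultimately show False by simp
  qed
  then obtain k y0 where "y0 \<in> interior (E k)" by blast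
  then obtain e where e: "0 < e" "cball y0 e \<subseteq> E k"
    by (meson mem_interior_cball)
  obtain B where B: "\<And>n. norm (T n (2 *\<^sub>R x - y0)) \<le> B" using ptw by (auto simp: bounded_iff)
  obtain C where C: "\<And>n. norm (T n x) \<le> C" using ptw[of x] by (auto simp: bounded_iff)
  \<comment> \<open>y is the midpoint of y0 + 2(y-x), which lies in the ball found by Baire when y
    is close to x, and of the fixed point 2x - y0, where the pointwise bound applies.\<close>
  have up: "T n y \<le> (1/2) *\<^sub>R T n (y0 + 2 *\<^sub>R (y - x)) + (1/2) *\<^sub>R T n (2 *\<^sub>R x - y0)" for n y
  proof -
    have "(1/2) *\<^sub>R (y0 + 2 *\<^sub>R (y - x)) + (1 - 1/2) *\<^sub>R (2 *\<^sub>R x - y0) = y"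
      by (simp add: algebra_simps)
    then show ?thesis
      using convex_operatorD[OF T(1), of "1/2" n "y0 + 2 *\<^sub>R (y - x)" "2 *\<^sub>R x - y0"] by simp
  qed
  define u where "u n y = (1/2) *\<^sub>R T n (y0 + 2 *\<^sub>R (y - x)) + (1/2) *\<^sub>R T n (2 *\<^sub>R x - y0)" for n y
  have u: "norm (u n y) \<le> real k + B" if "y \<in> cball x (e / 2)" for n y
  proof -
    have "norm (2 *\<^sub>R (y - x)) \<le> e" using that by (simp add: dist_norm norm_minus_commute)
    then have "y0 + 2 *\<^sub>R (y - x) \<in> E k" using e(2) by (intro subsetD[OF e(2)]) (simp add: dist_norm)
    then have "norm (T n (y0 + 2 *\<^sub>R (y - x))) \<le> real k" by (simp add: E_def)
    then have "norm (u n y) \<le> (1/2) * real k + (1/2) * B"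
      unfolding u_def using B[of n] by (intro norm_triangle_le) simp
    moreover have "0 \<le> B" using B[of n] norm_ge_zero order_trans by blast
    ultimately show ?thesis by simp
  qed
  have "norm (T n y) \<le> (2 * C + (real k + B)) + (real k + B)" if y: "y \<in> cball x (e / 2)" for n y
  proof -
    have y': "2 *\<^sub>R x - y \<in> cball x (e / 2)"
    proof -
      have "x - (2 *\<^sub>R x - y) = y - x" by (simp add: scaleR_2)
      then show ?thesis using y by (metis dist_norm mem_cball norm_minus_commute)
    qed
    \<comment> \<open>Reflection at x: since x is the midpoint of y and 2x - y, the upper bound at
      the reflected point becomes a lower bound at y.\<close>
    have "T n x \<le> (1/2) *\<^sub>R T n y + (1/2) *\<^sub>R T n (2 *\<^sub>R x - y)"
      using convex_operatorD[OF T(1), of "1/2" n y "2 *\<^sub>R x - y"] by (simp add: algebra_simps)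
    then have "2 *\<^sub>R T n x \<le> 2 *\<^sub>R ((1/2) *\<^sub>R T n y + (1/2) *\<^sub>R T n (2 *\<^sub>R x - y))"
      by (rule scaleR_left_mono) simp
    then have "2 *\<^sub>R T n x \<le> T n y + T n (2 *\<^sub>R x - y)" by (simp add: scaleR_add_right)
    also have "\<dots> \<le> T n y + u n (2 *\<^sub>R x - y)" using up unfolding u_def by (rule add_left_mono)
    finally have "2 *\<^sub>R T n x - u n (2 *\<^sub>R x - y) \<le> T n y" by (simp add: diff_le_eq)
    then have "norm (T n y) \<le> norm (2 *\<^sub>R T n x - u n (2 *\<^sub>R x - y)) + norm (u n y)"
      using up unfolding u_def by (rule norm_between)
    also have "norm (2 *\<^sub>R T n x - u n (2 *\<^sub>R x - y)) \<le> 2 * C + (real k + B)"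
      using C[of n] u[OF y'] by (intro norm_triangle_le_diff add_mono) simp_all
    also have "norm (u n y) \<le> real k + B" using u[OF y] .
    finally show ?thesis by simp
  qed
  then show ?thesis using half_gt_zero[OF e(1)] by blast
qed

section \<open>Densities of locally Lipschitz functions\<close>

lemma set_integrable_const_Icc: "set_integrable lborel {a..b::real} (\<lambda>_. c::real)"
  unfolding set_integrable_def by (intro integrable_indicator) (auto simp: emeasure_lborel_Icc_eq)

text \<open>After rescaling, \<open>t \<plusminus> g t\<close> are both nondecreasing; their Stieltjes measures sum to Lebesgue
  measure, which makes them absolutely continuous with densities at most \<open>1\<close>.\<close>

lemma lipschitz_density:
  fixes g :: "real \<Rightarrow> real"
  assumes L: "0 < L" and lip: "\<And>a b. \<bar>g b - g a\<bar> \<le> L * \<bar>b - a\<bar>"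
  shows "\<exists>f\<in>borel_measurable borel. (\<forall>x. \<bar>f x\<bar> \<le> L) \<and>
    (\<forall>a b. a \<le> b \<longrightarrow> (LBINT x:{a..b}. f x) = g b - g a)"
proof -
  define k where "k t = g t / L" for t
  \<comment> \<open>Halving makes the increments of the two functions for s = 1 and s = -1 add up to
    the length of the interval.\<close>
  define F :: "real \<Rightarrow> real \<Rightarrow> real" where "F s t = (t + s * k t) / 2" for s t
  define \<nu> where "\<nu> s = interval_measure (F s)" for s
  define sgns :: "real set" where "sgns = {1, -1}"
  have g_lip: "\<bar>k b - k a\<bar> \<le> \<bar>b - a\<bar>" for a b
    unfolding k_def using lip[of b a] L by (simp add: divide_simps abs_divide mult.commute flip: diff_divide_distrib)
  have F_mono: "F s a \<le> F s b" if "a \<le> b" "s \<in> sgns" for s a b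
    using g_lip[of b a] that by (auto simp: F_def sgns_def abs_le_iff)
  have "L-lipschitz_on UNIV g"
    using L lip by (intro lipschitz_onI) (auto simp: dist_real_def)
  then have g_cont: "continuous_on UNIV g" by (rule lipschitz_on_continuous_on)
  have "continuous_on UNIV (F s)" for s
    unfolding F_def k_def using L by (auto intro!: continuous_intros g_cont)
  then have F_cont: "continuous (at x) (F s)" for s x
    by (simp add: continuous_on_eq_continuous_at)
  have \<nu>_Ioc: "emeasure (\<nu> s) {a<..b} = ennreal (F s b - F s a)" if "a \<le> b" "s \<in> sgns" for s a b
    unfolding \<nu>_def using that F_mono F_cont
    by (intro emeasure_interval_measure_Ioc) (auto intro: continuous_at_imp_continuous_within)
  have \<nu>_Icc: "emeasure (\<nu> s) {a..b} = ennreal (F s b - F s a)" if "a \<le> b" "s \<in> sgns" for s a b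
    unfolding \<nu>_def using that F_mono F_cont
    by (intro emeasure_interval_measure_Icc) (auto simp: continuous_at_imp_continuous_on)
  have sets_\<nu>[measurable_cong, simp]: "sets (\<nu> s) = sets borel" for s
    by (simp add: \<nu>_def)
  have \<nu>_Ioo: "emeasure (\<nu> s) {a<..<b} = ennreal (F s b - F s a)" if "a \<le> b" "s \<in> sgns" for s a b
  proof -
    have "{b} \<in> null_sets (\<nu> s)"
      using \<nu>_Icc[of b b s] that by (intro null_setsI) auto
    then have "emeasure (\<nu> s) ({a<..b} - {b}) = emeasure (\<nu> s) {a<..b}"
      by (intro emeasure_Diff_null_set) auto
    moreover have "{a<..b} - {b} = {a<..<b}" by auto
    ultimately show ?thesis using \<nu>_Ioc that by simp
  qed
  \<comment> \<open>The sum of the two Stieltjes measures as a measure in its own right, to be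
    recognised as \<open>lborel\<close> by its values on open intervals.\<close>
  define N where "N = measure_of UNIV (sets borel) (\<lambda>A. emeasure (\<nu> 1) A + emeasure (\<nu> (-1)) A)"
  have N: "emeasure N A = emeasure (\<nu> 1) A + emeasure (\<nu> (-1)) A" if "A \<in> sets borel" for A
    unfolding N_def
  proof (rule emeasure_measure_of_sigma)
    show "sigma_algebra UNIV (sets (borel :: real measure))"
      using sets.sigma_algebra_axioms[of "borel :: real measure"] by simp
    show "positive (sets borel) (\<lambda>A. emeasure (\<nu> 1) A + emeasure (\<nu> (-1)) A)"
      by (simp add: positive_def)
    show "countably_additive (sets borel) (\<lambda>A. emeasure (\<nu> 1) A + emeasure (\<nu> (-1)) A)"
      unfolding countably_additive_def
      by (auto simp: suminf_emeasure simp flip: suminf_add)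
  qed (use that in auto)
  have lborel_eq: "lborel = N"
  proof (rule lborel_eqI)
    show "sets N = sets borel"
      unfolding N_def using sets.sigma_sets_eq[of "borel :: real measure"] by (simp add: sets.space_closed)
    fix l u :: real assume lu: "\<And>b. b \<in> Basis \<Longrightarrow> l \<bullet> b \<le> u \<bullet> b"
    then have "l \<le> u" by simp
    then have "emeasure N (box l u) = ennreal (F 1 u - F 1 l) + ennreal (F (-1) u - F (-1) l)"
      by (simp add: N \<nu>_Ioo sgns_def box_real)
    also have "\<dots> = ennreal ((F 1 u - F 1 l) + (F (-1) u - F (-1) l))"
      using F_mono[OF \<open>l \<le> u\<close>] by (intro ennreal_plus[symmetric]) (auto simp: sgns_def)
    also have "(F 1 u - F 1 l) + (F (-1) u - F (-1) l) = u - l" by (simp add: F_def field_simps)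
    finally show "emeasure N (box l u) = (\<Prod>b\<in>Basis. (u - l) \<bullet> b)" by simp
  qed
  have lborel_sum: "emeasure lborel A = emeasure (\<nu> 1) A + emeasure (\<nu> (-1)) A" if "A \<in> sets borel" for A
    using N[OF that] lborel_eq by simp
  have "\<exists>D\<in>borel_measurable lborel. density lborel D = \<nu> s" if s: "s \<in> sgns" for s
  proof (rule sigma_finite_measure.Radon_Nikodym[OF sigma_finite_lborel])
    show "absolutely_continuous lborel (\<nu> s)"
      unfolding absolutely_continuous_def
      using lborel_sum s by (auto simp: null_sets_def sgns_def)
  qed simp
  then have "\<exists>D\<in>borel_measurable lborel. density lborel D = \<nu> 1"
    "\<exists>D\<in>borel_measurable lborel. density lborel D = \<nu> (-1)" by (simp_all add: sgns_def)
  then obtain D D' where D[measurable]: "D \<in> borel_measurable borel" "D' \<in> borel_measurable borel"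
    and dD: "density lborel D = \<nu> 1" "density lborel D' = \<nu> (-1)" by auto
  have "density lborel (\<lambda>x. D x + D' x) = density lborel (\<lambda>_. 1)"
  proof (rule measure_eqI)
    fix A assume "A \<in> sets (density lborel (\<lambda>x. D x + D' x))"
    then have A[measurable]: "A \<in> sets borel" by simp
    have "emeasure (density lborel (\<lambda>x. D x + D' x)) A
        = (\<integral>\<^sup>+x. D x * indicator A x \<partial>lborel) + (\<integral>\<^sup>+x. D' x * indicator A x \<partial>lborel)"
      by (simp add: emeasure_density distrib_right nn_integral_add)
    also have "\<dots> = emeasure (density lborel D) A + emeasure (density lborel D') A"
      by (simp add: emeasure_density)
    also have "\<dots> = emeasure lborel A" by (simp add: dD lborel_sum)
    finally show "emeasure (density lborel (\<lambda>x. D x + D' x)) A = emeasure (density lborel (\<lambda>_. 1)) A"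
      by (simp add: emeasure_density)
  qed simp
  then have "AE x in lborel. D x + D' x = 1"
    by (subst (asm) sigma_finite_measure.density_unique_iff[OF sigma_finite_lborel]) auto
  \<comment> \<open>The densities add up to 1 only almost everywhere; truncating at 1 changes
    \<open>D\<close> on a null set and makes the bound on f hold at every point.\<close>
  then have D_le: "AE x in lborel. min (D x) 1 = D x"
  proof (rule AE_mp, intro AE_I2 impI)
    fix x assume "D x + D' x = 1"
    then have "D x \<le> 1" by (metis le_iff_add)
    then show "min (D x) 1 = D x" by (rule min_absorb1)
  qed
  define h where "h x = enn2real (min (D x) 1)" for x
  have h_meas[measurable]: "h \<in> borel_measurable borel" unfolding h_def by measurable
  have h_enn: "ennreal (h x) = min (D x) 1" for x
    unfolding h_def by (intro ennreal_enn2real) (metis ennreal_one_less_top min.cobounded2 order_le_less_trans)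
  have "ennreal (h x) \<le> ennreal 1" for x by (simp add: h_enn)
  then have h: "0 \<le> h x" "h x \<le> 1" for x
    by (simp_all add: h_def enn2real_nonneg ennreal_le_iff)
  have h_int: "(LBINT x:{a..b}. h x) = F 1 b - F 1 a" if "a \<le> b" for a b
  proof -
    have "(LBINT x:{a..b}. h x) = enn2real (\<integral>\<^sup>+x. ennreal (indicator {a..b} x * h x) \<partial>lborel)"
      unfolding set_lebesgue_integral_def using h by (simp add: integral_eq_nn_integral)
    also have "(\<integral>\<^sup>+x. ennreal (indicator {a..b} x * h x) \<partial>lborel)
        = (\<integral>\<^sup>+x. D x * indicator {a..b} x \<partial>lborel)"
      by (rule nn_integral_cong_AE, use D_le in eventually_elim)
        (auto simp: indicator_def h_enn)
    also have "\<dots> = emeasure (\<nu> 1) {a..b}" by (simp add: emeasure_density flip: dD)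
    also have "\<dots> = ennreal (F 1 b - F 1 a)" using that by (simp add: \<nu>_Icc sgns_def)
    finally show ?thesis using F_mono[OF that, of 1] by (simp add: sgns_def)
  qed
  have h_sint: "set_integrable lborel {a..b} h" for a b
  proof (rule set_integrable_bound)
    show "set_integrable lborel {a..b} (\<lambda>_. 1 :: real)" by (rule set_integrable_const_Icc)
    show "set_borel_measurable lborel {a..b} h" unfolding set_borel_measurable_def by measurable
  qed (use h in auto)
  \<comment> \<open>Inverts the rescaling: h is the density of (t + g(t)/L)/2.\<close>
  define f where "f x = L * (2 * h x - 1)" for x
  have "f \<in> borel_measurable borel" unfolding f_def by measurable
  moreover have "\<bar>f x\<bar> \<le> L" for x
  proof -
    have "\<bar>2 * h x - 1\<bar> \<le> 1" using h[of x] by (simp add: abs_le_iff)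
    then show ?thesis using L by (simp add: f_def abs_mult)
  qed
  moreover have "(LBINT x:{a..b}. f x) = g b - g a" if "a \<le> b" for a b
  proof -
    have "(LBINT x:{a..b}. f x) = L * (LBINT x:{a..b}. 2 * h x - 1)"
      unfolding f_def by simp
    also have "(LBINT x:{a..b}. 2 * h x - 1) = (LBINT x:{a..b}. 2 * h x) - (LBINT x:{a..b}. 1)"
      using h_sint by (intro set_integral_diff set_integrable_mult_right set_integrable_const_Icc) auto
    also have "(LBINT x:{a..b}. 2 * h x) = 2 * (LBINT x:{a..b}. h x)" by simp
    also have "(LBINT x:{a..b}. (1::real)) = b - a" using that by (simp add: set_lebesgue_integral_def)
    also have "L * (2 * (LBINT x:{a..b}. h x) - (b - a)) = g b - g a"
      using L that by (simp add: h_int F_def k_def field_simps)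
    finally show ?thesis .
  qed
  ultimately show ?thesis by blast
qed

text \<open>The difference, cut off outside [0,T], integrates to 0 over every half-line, so its
  positive and negative parts are densities of measures that agree on a generating family.\<close>

lemma AE_eq_of_integrals_eq:
  fixes f g :: "real \<Rightarrow> real"
  assumes f: "set_integrable lborel {0..T} f" and g: "set_integrable lborel {0..T} g"
    and eq: "\<And>t. 0 \<le> t \<Longrightarrow> t \<le> T \<Longrightarrow> (LBINT s:{0..t}. f s) = (LBINT s:{0..t}. g s)"
  shows "AE s in lborel. s \<in> {0..T} \<longrightarrow> f s = g s"
proof (cases "0 \<le> T")
  case True
  define h where "h s = indicator {0..T} s * f s - indicator {0..T} s * g s" for s
  have h_int: "integrable lborel h"
    using f g unfolding h_def set_integrable_def by (simp add: Bochner_Integration.integrable_diff)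
  then have [measurable]: "h \<in> borel_measurable borel" by simp
  have h_ind: "integrable lborel (\<lambda>s. h s * indicator A s)" if "A \<in> sets borel" for A
    using integrable_mult_indicator[OF _ h_int, of A] that by (simp add: mult.commute)
  have h0: "(\<integral>s. h s * indicator {..t} s \<partial>lborel) = 0" if "t \<le> T" for t
  proof (cases "0 \<le> t")
    case t: True
    have "h s * indicator {..t} s = indicator {0..t} s * f s - indicator {0..t} s * g s" for s
      using that t by (auto simp: h_def indicator_def)
    moreover have "set_integrable lborel {0..t} f" "set_integrable lborel {0..t} g"
      using f g that by (auto intro: set_integrable_subset)
    ultimately show ?thesis
      using eq[OF t that] by (simp add: set_integrable_def set_lebesgue_integral_def)
  next
    case False
    then have "(\<lambda>s. h s * indicator {..t} s) = (\<lambda>_. 0)" by (auto simp: h_def indicator_def)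
    then show ?thesis by (simp only: Bochner_Integration.integral_zero)
  qed
  have h_tot: "(\<integral>s. h s \<partial>lborel) = 0"
  proof -
    have "(\<lambda>s. h s * indicator {..T} s) = h" by (auto simp: h_def indicator_def)
    then show ?thesis using h0[of T] by simp
  qed
  have h1: "(\<integral>s. h s * indicator {t<..} s \<partial>lborel) = 0" for t
  proof (cases "t \<le> T")
    case t: True
    have "h s * indicator {t<..} s = h s - h s * indicator {..t} s" for s by (auto simp: indicator_def)
    then show ?thesis using h0[OF t] h_tot h_int h_ind[of "{..t}"] by simp
  next
    case False
    then have "(\<lambda>s. h s * indicator {t<..} s) = (\<lambda>_. 0)" by (auto simp: h_def indicator_def)
    then show ?thesis by (simp only: Bochner_Integration.integral_zero)
  qed
  have fin: "(\<integral>\<^sup>+s. ennreal (h s * indicator {t<..} s) \<partial>lborel) < \<infinity>"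
      "(\<integral>\<^sup>+s. ennreal (- (h s * indicator {t<..} s)) \<partial>lborel) < \<infinity>" for t
    using h_ind[of "{t<..}"] unfolding real_integrable_def by (auto simp: less_top)
  have em: "emeasure (density lborel (\<lambda>s. ennreal (h s))) {t<..} = (\<integral>\<^sup>+s. ennreal (h s * indicator {t<..} s) \<partial>lborel)"
    "emeasure (density lborel (\<lambda>s. ennreal (- h s))) {t<..} = (\<integral>\<^sup>+s. ennreal (- (h s * indicator {t<..} s)) \<partial>lborel)" for t
    by (auto simp: emeasure_density indicator_def intro!: nn_integral_cong)
  \<comment> \<open>\<open>ennreal\<close> sends negative numbers to 0, so the two densities are the
    positive and the negative part of h.\<close>
  have "density lborel (\<lambda>s. ennreal (h s)) = density lborel (\<lambda>s. ennreal (- h s))"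
  proof (rule measure_eqI_lessThan)
    fix t
    show "emeasure (density lborel (\<lambda>s. ennreal (h s))) {t<..} < \<infinity>" using fin em by simp
    have "enn2real (\<integral>\<^sup>+s. ennreal (h s * indicator {t<..} s) \<partial>lborel)
        = enn2real (\<integral>\<^sup>+s. ennreal (- (h s * indicator {t<..} s)) \<partial>lborel)"
      using h1[of t] real_lebesgue_integral_def[OF h_ind[of "{t<..}"]] by simp
    then show "emeasure (density lborel (\<lambda>s. ennreal (h s))) {t<..} = emeasure (density lborel (\<lambda>s. ennreal (- h s))) {t<..}"
      unfolding em using fin[of t] by (metis ennreal_enn2real infinity_ennreal_def)
  qed auto
  then have "AE s in lborel. ennreal (h s) = ennreal (- h s)"
    by (subst (asm) sigma_finite_measure.density_unique_iff[OF sigma_finite_lborel]) auto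
  then show ?thesis
  proof (rule AE_mp, intro AE_I2 impI)
    fix s assume e: "ennreal (h s) = ennreal (- h s)" and s: "s \<in> {0..T}"
    have "h s = 0"
    proof (cases "0 \<le> h s")
      case True
      then have "ennreal (h s) = 0" using e by (simp add: ennreal_neg)
      then show ?thesis using True by (simp add: ennreal_eq_0_iff)
    next
      case False
      then have "ennreal (- h s) = 0" using e by (simp add: ennreal_neg)
      then show ?thesis using False by (simp add: ennreal_eq_0_iff)
    qed
    then show "f s = g s" using s by (simp add: h_def)
  qed
qed simp

section \<open>Functions on the half-line that are Lipschitz on bounded intervals\<close>

definition locally_lipschitz :: "(real \<Rightarrow> real) \<Rightarrow> bool" where
  "locally_lipschitz g \<longleftrightarrow>
     (\<forall>T\<ge>0. \<exists>L. \<forall>a\<in>{0..T}. \<forall>b\<in>{0..T}. \<bar>g b - g a\<bar> \<le> L * \<bar>b - a\<bar>)"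

lemma set_integrable_bounded_interval:
  fixes f :: "real \<Rightarrow> real"
  assumes f: "set_borel_measurable borel {0..} f" and bdd: "bounded (f ` {0..t})"
  shows "set_integrable lborel {0..t} f"
proof -
  obtain B where B: "\<And>s. s \<in> {0..t} \<Longrightarrow> \<bar>f s\<bar> \<le> B" using bdd by (fastforce simp: bounded_iff)
  show ?thesis
  proof (rule set_integrable_bound)
    show "set_integrable lborel {0..t} (\<lambda>_. B)" by (rule set_integrable_const_Icc)
    show "set_borel_measurable lborel {0..t} f"
      using set_borel_measurable_subset[OF f, of "{0..t}"] by (simp add: set_borel_measurable_def)
    show "AE s in lborel. s \<in> {0..t} \<longrightarrow> norm (f s) \<le> norm B"
      using B by (intro AE_I2) (force simp: abs_le_iff)
  qed
qed

text \<open>Clamping the argument to [0,T] is nonexpansive and so gives a globally Lipschitz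
  function, the form \<open>lipschitz_density\<close> accepts; \<open>max L 1\<close> secures a
  positive constant.\<close>

lemma locally_lipschitz_clamp:
  assumes "locally_lipschitz g" "0 \<le> T"
  shows "\<exists>L>0. \<forall>a b. \<bar>g (max 0 (min b T)) - g (max 0 (min a T))\<bar> \<le> L * \<bar>b - a\<bar>"
proof -
  obtain L where L: "\<forall>a\<in>{0..T}. \<forall>b\<in>{0..T}. \<bar>g b - g a\<bar> \<le> L * \<bar>b - a\<bar>"
    using assms unfolding locally_lipschitz_def by blast
  have "\<bar>g (max 0 (min b T)) - g (max 0 (min a T))\<bar> \<le> max L 1 * \<bar>b - a\<bar>" for a b
  proof -
    have "\<bar>g (max 0 (min b T)) - g (max 0 (min a T))\<bar> \<le> L * \<bar>max 0 (min b T) - max 0 (min a T)\<bar>"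
      using L assms(2) by auto
    also have "\<dots> \<le> max L 1 * \<bar>max 0 (min b T) - max 0 (min a T)\<bar>"
      by (intro mult_right_mono) auto
    also have "\<dots> \<le> max L 1 * \<bar>b - a\<bar>" by (intro mult_left_mono) auto
    finally show ?thesis .
  qed
  then show ?thesis by (intro exI[of _ "max L 1"]) auto
qed

text \<open>Densities for the clamped functions on [0,n] are glued together. They agree almost
  everywhere where they overlap, because they have the same integrals there.\<close>

lemma locally_lipschitz_density:
  assumes g: "locally_lipschitz g"
  shows "\<exists>f\<in>borel_measurable borel. (\<forall>t\<ge>0. bounded (f ` {0..t})) \<and>
    (\<forall>t\<ge>0. g t = g 0 + (LBINT s:{0..t}. f s))"
proof -
  define gc where "gc n t = g (max 0 (min t (real n)))" for n :: nat and t
  have "\<exists>L>0. \<forall>a b. \<bar>gc n b - gc n a\<bar> \<le> L * \<bar>b - a\<bar>" for n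
    unfolding gc_def using locally_lipschitz_clamp[OF g] by simp
  then obtain L where L: "\<And>n. 0 < L n" "\<And>n a b. \<bar>gc n b - gc n a\<bar> \<le> L n * \<bar>b - a\<bar>" by metis
  have "\<exists>f\<in>borel_measurable borel. (\<forall>x. \<bar>f x\<bar> \<le> L n) \<and>
      (\<forall>a b. a \<le> b \<longrightarrow> (LBINT x:{a..b}. f x) = gc n b - gc n a)" for n
    by (intro lipschitz_density L)
  then obtain fn where fn[measurable]: "\<And>n. fn n \<in> borel_measurable borel"
    and fn_le: "\<And>n x. \<bar>fn n x\<bar> \<le> L n"
    and fn_int: "\<And>n a b. a \<le> b \<Longrightarrow> (LBINT x:{a..b}. fn n x) = gc n b - gc n a" by metis
  have fn_sint: "set_integrable lborel {0..t} (fn n)" for n t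
  proof (rule set_integrable_bounded_interval)
    show "set_borel_measurable borel {0..} (fn n)" unfolding set_borel_measurable_def by measurable
    show "bounded (fn n ` {0..t})" using fn_le[of n] by (auto simp: bounded_iff)
  qed
  have fn_int0: "(LBINT x:{0..t}. fn n x) = g t - g 0" if "0 \<le> t" "t \<le> real n" for n t
    using that by (simp add: fn_int gc_def)
  \<comment> \<open>The index is at least t, so the chosen density belongs to an interval containing
    t; it is a measurable, countably valued function of t.\<close>
  define f where "f t = fn (nat \<lceil>t\<rceil>) t" for t
  have f_meas[measurable]: "f \<in> borel_measurable borel"
    unfolding f_def
    by (rule measurable_compose_countable[where f = "\<lambda>n t. fn n t" and g = "\<lambda>t. nat \<lceil>t\<rceil>"]) measurable
  have index_le: "nat \<lceil>s\<rceil> \<le> nat \<lceil>t\<rceil>" if "s \<in> {0..t}" for s t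
    using that by (intro nat_mono ceiling_mono) auto
  have "bounded (f ` {0..t})" for t
  proof -
    \<comment> \<open>The constants need not increase with n; the sum of these positive numbers
      dominates each of them.\<close>
    have "\<bar>f s\<bar> \<le> (\<Sum>n\<le>nat \<lceil>t\<rceil>. L n)" if "s \<in> {0..t}" for s
    proof -
      have "\<bar>f s\<bar> \<le> L (nat \<lceil>s\<rceil>)" unfolding f_def by (rule fn_le)
      also have "\<dots> \<le> (\<Sum>n\<le>nat \<lceil>t\<rceil>. L n)"
        using index_le[OF that] L(1) by (intro member_le_sum) (auto intro: less_imp_le)
      finally show ?thesis .
    qed
    then show ?thesis by (auto simp: bounded_iff intro!: exI[of _ "\<Sum>n\<le>nat \<lceil>t\<rceil>. L n"])
  qed
  moreover have "g t = g 0 + (LBINT s:{0..t}. f s)" if t: "0 \<le> t" for t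
  proof -
    define N where "N = nat \<lceil>t\<rceil>"
    have tN: "t \<le> real N" unfolding N_def by linarith
    have "AE s in lborel. s \<in> {0..real n} \<longrightarrow> fn n s = fn N s" if "n \<le> N" for n
      using that by (intro AE_eq_of_integrals_eq fn_sint) (simp_all add: fn_int0)
    then have "AE s in lborel. \<forall>n\<in>{..N}. s \<in> {0..real n} \<longrightarrow> fn n s = fn N s"
      by (intro AE_finite_allI) auto
    then have "AE s in lborel. s \<in> {0..t} \<longrightarrow> f s = fn N s"
    proof (rule AE_mp, intro AE_I2 impI)
      fix s assume a: "\<forall>n\<in>{..N}. s \<in> {0..real n} \<longrightarrow> fn n s = fn N s" and s: "s \<in> {0..t}"
      have "s \<in> {0..real (nat \<lceil>s\<rceil>)}" using s by simp
      then show "f s = fn N s" using a index_le[OF s] unfolding f_def N_def by blast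
    qed
    then have "(LBINT s:{0..t}. f s) = (LBINT s:{0..t}. fn N s)"
      by (intro set_lebesgue_integral_cong_AE) (auto simp: set_borel_measurable_def)
    also have "\<dots> = g t - g 0" using t tN by (rule fn_int0)
    finally show ?thesis by simp
  qed
  ultimately show ?thesis using f_meas by blast
qed

text \<open>The quotients along one sequence of steps are bounded by the Lipschitz constant, so
  dominated convergence applies. Their integrals are differences of averages of g over short
  intervals at t and at 0, which tend to g t - g 0.\<close>

lemma locally_lipschitz_right_derivative:
  assumes g: "locally_lipschitz g"
    and G: "\<And>t. 0 \<le> t \<Longrightarrow> (\<lambda>n. (g (t + 1 / real (Suc n)) - g t) * real (Suc n)) \<longlonglongrightarrow> G t"
  shows "set_borel_measurable borel {0..} G" "\<And>t. 0 \<le> t \<Longrightarrow> bounded (G ` {0..t})"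
    "\<And>t. 0 \<le> t \<Longrightarrow> g t = g 0 + (LBINT s:{0..t}. G s)"
proof -
  \<comment> \<open>Constant extension to the left makes a function continuous on the whole line, as
    the global antiderivative P below requires.\<close>
  define h where "h t = g (max 0 t)" for t
  have h_cont: "isCont h t" for t
  proof -
    define T where "T = max 0 (t + 1)"
    obtain L where L: "\<And>a b. \<bar>g (max 0 (min b T)) - g (max 0 (min a T))\<bar> \<le> L * \<bar>b - a\<bar>" "0 < L"
      using locally_lipschitz_clamp[OF g, of T] by (auto simp: T_def)
    have "L-lipschitz_on UNIV (\<lambda>t. g (max 0 (min t T)))"
      using L by (intro lipschitz_onI) (auto simp: dist_real_def)
    then have "continuous_on UNIV (\<lambda>t. g (max 0 (min t T)))" by (rule lipschitz_on_continuous_on)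
    then have "isCont (\<lambda>t. g (max 0 (min t T))) t" by (simp add: continuous_on_eq_continuous_at)
    moreover have "\<forall>\<^sub>F s in nhds t. h s = g (max 0 (min s T))"
      unfolding eventually_nhds
      by (intro exI[of _ "{..<t + 1}"]) (auto simp: h_def T_def max_def min_def)
    ultimately show ?thesis by (simp add: isCont_cong)
  qed
  then have "continuous_on UNIV h" by (simp add: continuous_on_eq_continuous_at)
  then have h_meas[measurable]: "h \<in> borel_measurable borel" by (rule borel_measurable_continuous_onI)
  define q where "q n t = (h (t + 1 / real (Suc n)) - h t) * real (Suc n)" for n t
  have q_meas[measurable]: "q n \<in> borel_measurable borel" for n unfolding q_def by measurable
  have q_lim: "(\<lambda>n. q n t) \<longlonglongrightarrow> G t" if "0 \<le> t" for t
  proof -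
    have "q n t = (g (t + 1 / real (Suc n)) - g t) * real (Suc n)" for n
      using that by (simp add: q_def h_def)
    then show ?thesis using G[OF that] by simp
  qed
  have lim_ind: "(\<lambda>n. indicator A t * q n t) \<longlonglongrightarrow> indicator A t * G t" if "A \<subseteq> {0..}" for A t
    using q_lim[of t] that by (auto simp: indicator_def)
  show G_meas: "set_borel_measurable borel {0..} G"
    unfolding set_borel_measurable_def
  proof (rule borel_measurable_LIMSEQ_real)
    show "(\<lambda>n. indicator {0..} t * q n t) \<longlonglongrightarrow> indicator {0..} t *\<^sub>R G t" for t
      using lim_ind[of "{0..}" t] by simp
  qed measurable
  have q_bound: "\<exists>L. \<forall>n. \<forall>s\<in>{0..t}. \<bar>q n s\<bar> \<le> L" if t: "0 \<le> t" for t
  proof -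
    \<comment> \<open>All steps are at most 1, so both points of each quotient lie in
      [0,t+1].\<close>
    obtain L where L: "\<forall>a\<in>{0..t+1}. \<forall>b\<in>{0..t+1}. \<bar>g b - g a\<bar> \<le> L * \<bar>b - a\<bar>"
      using g t unfolding locally_lipschitz_def by (meson add_nonneg_nonneg zero_le_one)
    have "\<bar>q n s\<bar> \<le> L" if s: "s \<in> {0..t}" for n s
    proof -
      have d: "0 < 1 / real (Suc n)" "1 / real (Suc n) \<le> 1" by auto
      have "s + 1 / real (Suc n) \<in> {0..t+1}" "s \<in> {0..t+1}"
        using s d unfolding atLeastAtMost_iff by linarith+
      then have "\<bar>g (s + 1 / real (Suc n)) - g s\<bar> \<le> L * (1 / real (Suc n))"
        using L d(1) by fastforce
      then have "\<bar>g (s + 1 / real (Suc n)) - g s\<bar> * real (Suc n) \<le> L"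
        by (simp add: field_simps)
      then show ?thesis using s d by (simp add: q_def h_def abs_mult)
    qed
    then show ?thesis by blast
  qed
  have G_bound: "\<exists>L. \<forall>s\<in>{0..t}. \<bar>G s\<bar> \<le> L" if t: "0 \<le> t" for t
  proof -
    obtain L where L: "\<And>n s. s \<in> {0..t} \<Longrightarrow> \<bar>q n s\<bar> \<le> L" using q_bound[OF t] by blast
    have "\<bar>G s\<bar> \<le> L" if s: "s \<in> {0..t}" for s
    proof (rule LIMSEQ_le_const2)
      show "(\<lambda>n. \<bar>q n s\<bar>) \<longlonglongrightarrow> \<bar>G s\<bar>" using q_lim s by (intro tendsto_rabs) auto
    qed (use L[OF s] in auto)
    then show ?thesis by blast
  qed
  then show "bounded (G ` {0..t})" if "0 \<le> t" for t
    using that by (fastforce simp: bounded_iff)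
  fix t :: real assume t: "0 \<le> t"
  obtain L where L: "\<And>n s. s \<in> {0..t} \<Longrightarrow> \<bar>q n s\<bar> \<le> L" using q_bound[OF t] by blast
  have "(\<lambda>n. \<integral>s. indicator {0..t} s * q n s \<partial>lborel) \<longlonglongrightarrow> (\<integral>s. indicator {0..t} s * G s \<partial>lborel)"
  proof (rule integral_dominated_convergence)
    show "integrable lborel (\<lambda>s. indicator {0..t} s * L)"
      using set_integrable_const_Icc[of 0 t L] by (simp add: set_integrable_def)
    show "(\<lambda>s. indicator {0..t} s * G s) \<in> borel_measurable lborel"
      using set_borel_measurable_subset[OF G_meas, of "{0..t}"] by (simp add: set_borel_measurable_def)
    show "AE s in lborel. (\<lambda>n. indicator {0..t} s * q n s) \<longlonglongrightarrow> indicator {0..t} s * G s"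
      by (intro AE_I2 lim_ind) auto
    show "AE s in lborel. norm (indicator {0..t} s * q n s) \<le> indicator {0..t} s * L" for n
      using L by (intro AE_I2) (auto simp: indicator_def)
  qed auto
  moreover have "(\<lambda>n. \<integral>s. indicator {0..t} s * q n s \<partial>lborel) \<longlonglongrightarrow> h t - h 0"
  proof -
    obtain P where P: "\<And>s. (P has_real_derivative h s) (at s)"
      using einterval_antiderivative[of "-\<infinity>" "\<infinity>" h] h_cont
      by (auto simp: has_real_derivative_iff_has_vector_derivative)
    \<comment> \<open>The mean of h over an interval of length 1/(n+1) starting at s. It is an
      antiderivative of \<open>q n\<close>, so the integral is evaluated by the fundamental
      theorem.\<close>
    define Q where "Q n s = (P (s + 1 / real (Suc n)) - P s) * real (Suc n)" for n s
    have "(\<integral>s. q n s * indicator {0..t} s \<partial>lborel) = Q n t - Q n 0" for n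
    proof (rule integral_FTC_Icc_real)
      fix s
      have "((\<lambda>s. P (s + 1 / real (Suc n))) has_real_derivative h (s + 1 / real (Suc n))) (at s)"
        by (rule DERIV_shift[THEN iffD1, OF P])
      then show "(Q n has_real_derivative q n s) (at s)"
        unfolding Q_def q_def by (intro DERIV_cmult_right DERIV_diff P)
      have "isCont (\<lambda>s. h (s + 1 / real (Suc n))) s" by (rule isCont_o2[OF _ h_cont]) simp
      then show "isCont (q n) s" unfolding q_def using h_cont[of s] by (intro continuous_intros)
    qed (use t in auto)
    then have int: "(\<integral>s. indicator {0..t} s * q n s \<partial>lborel) = Q n t - Q n 0" for n
      by (simp add: mult.commute)
    have "(\<lambda>n. Q n s) \<longlonglongrightarrow> h s" for s
    proof -
      have "((\<lambda>e. (P (s + e) - P s) / e) \<longlongrightarrow> h s) (at 0)" using P[of s] by (simp add: DERIV_def)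
      moreover have "filterlim (\<lambda>n. 1 / real (Suc n)) (at 0) sequentially"
        using LIMSEQ_inverse_real_of_nat by (auto simp: filterlim_at inverse_eq_divide)
      ultimately have "(\<lambda>n. (P (s + 1 / real (Suc n)) - P s) / (1 / real (Suc n))) \<longlonglongrightarrow> h s"
        by (rule filterlim_compose)
      then show ?thesis by (simp add: Q_def)
    qed
    then show ?thesis unfolding int by (intro tendsto_diff)
  qed
  ultimately have "(\<integral>s. indicator {0..t} s * G s \<partial>lborel) = h t - h 0" by (rule LIMSEQ_unique)
  then show "g t = g 0 + (LBINT s:{0..t}. G s)"
    using t by (simp add: h_def set_lebesgue_integral_def)
qed

section \<open>Orbits of convex semigroups\<close>

locale convex_C0_semigroup = banach_pair j
  for j :: "'a::banach_lattice \<Rightarrow> 'b::dedekind_sigma_complete_riesz_space" +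
  fixes S :: "real \<Rightarrow> 'a \<Rightarrow> 'a"
  assumes separates: "M_separates_points j" and C0: "C0_semigroup S" and convex: "convex_semigroup S"
begin

lemma S_convex: "0 \<le> t \<Longrightarrow> convex_operator_on UNIV (S t)"
  using convex by (simp add: convex_semigroup_def)

lemma S_bounded: "0 \<le> t \<Longrightarrow> bounded_operator (S t)"
  and S_0: "S 0 x = x"
  and S_add: "0 \<le> s \<Longrightarrow> 0 \<le> t \<Longrightarrow> S (t + s) x = S t (S s x)"
  and S_tendsto: "((\<lambda>t. S t x) \<longlongrightarrow> x) (at_right 0)"
  using C0 by (simp_all add: C0_semigroup_def)

text \<open>Otherwise there are times t n tending to 0 and points y n tending to x with unbounded
  images. Strong continuity at 0 makes the operators S(t n) pointwise bounded, and
  \<open>convex_uniform_boundedness\<close> then contradicts the choice.\<close>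

lemma S_bounded_near_0: "\<exists>\<delta>>0. \<exists>r>0. \<exists>K. \<forall>t\<in>{0..\<delta>}. \<forall>y\<in>cball x r. norm (S t y) \<le> K"
proof (rule ccontr)
  assume neg: "\<not> ?thesis"
  have "\<exists>t y. 0 \<le> t \<and> t \<le> 1 / real (Suc n) \<and> norm (x - y) \<le> 1 / real (Suc n) \<and> real n < norm (S t y)" for n
  proof (rule ccontr)
    assume "\<not> ?thesis"
    then have "\<forall>t\<in>{0..1 / real (Suc n)}. \<forall>y\<in>cball x (1 / real (Suc n)). norm (S t y) \<le> real n"
      by (auto simp: dist_norm not_less)
    moreover have "0 < 1 / real (Suc n)" by simp
    ultimately show False using neg by blast
  qed
  then obtain t y where t: "\<And>n. 0 \<le> t n" "\<And>n. t n \<le> 1 / real (Suc n)"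
    and y: "\<And>n. norm (x - y n) \<le> 1 / real (Suc n)" and large: "\<And>n. real n < norm (S (t n) (y n))"
    by metis
  have "t \<longlonglongrightarrow> 0"
    using LIMSEQ_inverse_real_of_nat t
    by (intro tendsto_sandwich[of "\<lambda>_. 0" t sequentially "\<lambda>n. 1 / real (Suc n)"]) (auto simp: inverse_eq_divide)
  have "bounded (range (\<lambda>n. S (t n) z))" for z
  proof -
    \<comment> \<open>The times t n may equal 0, which the right-hand limit excludes; hence the
      passage to the closed half-line.\<close>
    have "((\<lambda>t. S t z) \<longlongrightarrow> S 0 z) (at 0 within {0..})"
    proof -
      show ?thesis using S_tendsto[of z] by (simp add: S_0 at_within_Ici_at_right)
    qed
    then have "continuous (at 0 within {0..}) (\<lambda>t. S t z)" by (simp add: continuous_within)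
    then have "(\<lambda>n. S (t n) z) \<longlonglongrightarrow> S 0 z"
      using \<open>t \<longlonglongrightarrow> 0\<close> t(1) unfolding continuous_within_sequentially by (auto simp: o_def)
    then show ?thesis by (rule convergent_imp_bounded)
  qed
  then obtain r K where r: "0 < r" "\<And>n y. y \<in> cball x r \<Longrightarrow> norm (S (t n) y) \<le> K"
    using convex_uniform_boundedness[of "\<lambda>n. S (t n)" x] S_convex S_bounded t(1) by metis
  obtain m where m: "1 / real (Suc m) < r" using r(1) nat_approx_posE by blast
  obtain k where k: "K \<le> real k" using real_arch_simple by blast
  define n where "n = max m k"
  have "1 / real (Suc n) \<le> 1 / real (Suc m)" by (simp add: n_def field_simps)
  then have "y n \<in> cball x r" using y[of n] m by (simp add: dist_norm)
  then have "norm (S (t n) (y n)) \<le> K" by (rule r(2))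
  moreover have "K \<le> real n" using k by (simp add: n_def)
  ultimately show False using large[of n] by simp
qed

text \<open>Induction over multiples of delta with the operator S(delta) applied last: it is bounded
  on norm balls, so the radius r does not shrink from step to step.\<close>

lemma S_bounded_on:
  "\<exists>r>0. \<exists>K. \<forall>t\<in>{0..T}. \<forall>y\<in>cball x r. norm (S t y) \<le> K"
proof -
  obtain \<delta> r K where \<delta>: "0 < \<delta>" and r: "0 < r"
    and K: "\<And>t y. t \<in> {0..\<delta>} \<Longrightarrow> y \<in> cball x r \<Longrightarrow> norm (S t y) \<le> K"
    using S_bounded_near_0[of x] by metis
  have "\<exists>K. \<forall>t\<in>{0..real n * \<delta>}. \<forall>y\<in>cball x r. norm (S t y) \<le> K" for n
  proof (induction n)
    case 0
    have "norm (S t y) \<le> K" if "t \<in> {0..real 0 * \<delta>}" "y \<in> cball x r" for t y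
      using K[of t y] that \<delta> by simp
    then show ?case by blast
  next
    case (Suc n)
    then obtain K' where K': "\<And>t y. t \<in> {0..real n * \<delta>} \<Longrightarrow> y \<in> cball x r \<Longrightarrow> norm (S t y) \<le> K'" by blast
    obtain K'' where K'': "\<And>y. norm y \<le> K' \<Longrightarrow> norm (S \<delta> y) \<le> K''"
      using bounded_operatorD[OF S_bounded, of \<delta> K'] \<delta> by auto
    have "norm (S t y) \<le> max K K''" if t: "t \<in> {0..real (Suc n) * \<delta>}" and y: "y \<in> cball x r" for t y
    proof (cases "t \<le> \<delta>")
      case True
      then show ?thesis using K[of t y] t y by auto
    next
      case False
      then have "t - \<delta> \<in> {0..real n * \<delta>}" using t by (auto simp: algebra_simps)
      then have "norm (S \<delta> (S (t - \<delta>) y)) \<le> K''" using y by (intro K'' K')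
      moreover have "S \<delta> (S (t - \<delta>) y) = S t y" using False \<delta> S_add[of "t - \<delta>" \<delta>] by simp
      ultimately show ?thesis by simp
    qed
    then show ?case by blast
  qed
  moreover obtain n where "T / \<delta> \<le> real n" using real_arch_simple by blast
  then have "{0..T} \<subseteq> {0..real n * \<delta>}" using \<delta> by (auto simp: field_simps)
  ultimately show ?thesis using r by (meson subsetD)
qed

lemma S_lipschitz_on:
  obtains r L where "0 < r" "0 \<le> L"
    "\<And>t y. t \<in> {0..T} \<Longrightarrow> y \<in> cball x r \<Longrightarrow> norm (S t y - S t x) \<le> L * norm (y - x)"
proof -
  obtain r K where r: "0 < r" and K: "\<And>t y. t \<in> {0..T} \<Longrightarrow> y \<in> cball x r \<Longrightarrow> norm (S t y) \<le> K"
    using S_bounded_on[of T x] by metis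
  have "norm (S t y - S t x) \<le> max 0 (4 * K / r) * norm (y - x)"
    if "t \<in> {0..T}" "y \<in> cball x r" for t y
  proof -
    have "norm (S t y - S t x) \<le> 4 * K / r * norm (y - x)"
      using that r by (intro convex_lipschitz S_convex K) auto
    also have "\<dots> \<le> max 0 (4 * K / r) * norm (y - x)" by (intro mult_right_mono) auto
    finally show ?thesis .
  qed
  then show ?thesis using that[of r "max 0 (4 * K / r)"] r by simp
qed

section \<open>Lipschitz set and Lipschitz orbits\<close>

lemma norm_difference_quotient:
  "0 < h \<Longrightarrow> norm (difference_quotient S x h) = norm (S h x - x) / h"
  unfolding difference_quotient_def norm_scaleR by (simp add: divide_inverse mult.commute)

lemma lipschitz_setD:
  assumes "x \<in> lipschitz_set S"
  obtains h0 C where "0 < h0" "0 \<le> C" "\<And>h. h \<in> {0..h0} \<Longrightarrow> norm (S h x - x) \<le> C * h"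
proof -
  obtain h0 where h0: "0 < h0" "bounded (difference_quotient S x ` {0<..h0})"
    using assms by (auto simp: lipschitz_set_def)
  then obtain C where C: "0 < C" "\<And>h. h \<in> {0<..h0} \<Longrightarrow> norm (difference_quotient S x h) \<le> C"
    by (auto simp: bounded_pos)
  have "norm (S h x - x) \<le> C * h" if "h \<in> {0..h0}" for h
  proof (cases "h = 0")
    case False
    then have "0 < h" "norm (difference_quotient S x h) \<le> C" using that C(2)[of h] by auto
    then show ?thesis by (simp add: norm_difference_quotient pos_divide_le_eq)
  qed (simp add: S_0)
  then show ?thesis using that[of h0 C] h0 C by simp
qed

text \<open>S(h)S(t)x = S(t)S(h)x, and S(t) is Lipschitz near x, so the bound on S(h)x - x is
  carried along the orbit.\<close>

lemma lipschitz_set_invariant: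
  assumes x: "x \<in> lipschitz_set S" and t: "0 \<le> t"
  shows "S t x \<in> lipschitz_set S"
proof -
  obtain h0 C where h0: "0 < h0" "0 \<le> C" and C: "\<And>h. h \<in> {0..h0} \<Longrightarrow> norm (S h x - x) \<le> C * h"
    using lipschitz_setD[OF x] by blast
  obtain L where L: "0 \<le> L"
    "\<And>y z. y \<in> cball x 1 \<Longrightarrow> z \<in> cball x 1 \<Longrightarrow> norm (S t y - S t z) \<le> L * norm (y - z)"
    using convex_bounded_locally_lipschitz[OF S_convex S_bounded, of t x] t by blast
  \<comment> \<open>Keeps S(h)x in the unit ball at x; C + 1 avoids division by 0.\<close>
  define h1 where "h1 = min h0 (1 / (C + 1))"
  have h1: "0 < h1" "h1 \<le> h0" "C * h1 \<le> 1"
  proof -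
    show "0 < h1" "h1 \<le> h0" using h0 by (auto simp: h1_def)
    have "C * h1 \<le> C * (1 / (C + 1))" using h0 by (intro mult_left_mono) (auto simp: h1_def)
    also have "\<dots> \<le> 1" using h0 by (simp add: field_simps)
    finally show "C * h1 \<le> 1" .
  qed
  have "norm (difference_quotient S (S t x) h) \<le> L * C" if h: "h \<in> {0<..h1}" for h
  proof -
    have n: "norm (S h x - x) \<le> C * h" using h h1 by (intro C) auto
    also have "\<dots> \<le> 1" using h h1(3) h0 by (meson greaterThanAtMost_iff mult_left_mono order_trans)
    finally have "S h x \<in> cball x 1" by (simp add: dist_norm norm_minus_commute)
    then have "norm (S t (S h x) - S t x) \<le> L * norm (S h x - x)" by (intro L) auto
    also have "\<dots> \<le> L * (C * h)" using n L(1) by (rule mult_left_mono)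
    finally have "norm (S h (S t x) - S t x) \<le> L * C * h"
      using S_add[of h t x] S_add[of t h x] h t by (simp add: add.commute mult.assoc)
    then show ?thesis using h by (simp add: norm_difference_quotient pos_divide_le_eq)
  qed
  then have "bounded (difference_quotient S (S t x) ` {0<..h1})" unfolding bounded_iff by blast
  then show ?thesis using h1(1) unfolding lipschitz_set_def by blast
qed

lemma orbit_lipschitz:
  assumes x: "x \<in> lipschitz_set S"
  shows "\<exists>L. \<forall>a\<in>{0..T}. \<forall>b\<in>{0..T}. norm (S b x - S a x) \<le> L * \<bar>b - a\<bar>"
proof -
  obtain h0 C where h0: "0 < h0" "0 \<le> C" and C: "\<And>h. h \<in> {0..h0} \<Longrightarrow> norm (S h x - x) \<le> C * h"
    using lipschitz_setD[OF x] by blast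
  obtain r L where r: "0 < r" "0 \<le> L"
    and L: "\<And>t y. t \<in> {0..T} \<Longrightarrow> y \<in> cball x r \<Longrightarrow> norm (S t y - S t x) \<le> L * norm (y - x)"
    using S_lipschitz_on[where T = T and x = x] by blast
  obtain K where K: "\<And>t. t \<in> {0..T} \<Longrightarrow> norm (S t x) \<le> K"
    using S_bounded_on[of T x] by (metis centre_in_cball less_imp_le)
  define h1 where "h1 = min h0 (r / (C + 1))"
  have h1: "0 < h1" "h1 \<le> h0" "C * h1 \<le> r"
  proof -
    show "0 < h1" "h1 \<le> h0" using h0 r by (auto simp: h1_def)
    have "C * h1 \<le> C * (r / (C + 1))" using h0 by (intro mult_left_mono) (auto simp: h1_def)
    also have "\<dots> \<le> r" using h0 r by (simp add: field_simps)
    finally show "C * h1 \<le> r" .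
  qed
  \<comment> \<open>The first constant serves increments up to \<open>h1\<close>, where the
    Lipschitz bound at x applies uniformly in time; for longer ones the crude bound 2K
    suffices.\<close>
  define B where "B = max (L * C) (2 * K / h1)"
  have le: "norm (S b x - S a x) \<le> B * (b - a)" if "a \<in> {0..T}" "b \<in> {0..T}" "a \<le> b" for a b
  proof (cases "b - a \<le> h1")
    case True
    have n: "norm (S (b - a) x - x) \<le> C * (b - a)" using that True h1 by (intro C) auto
    also have "\<dots> \<le> r" using True h1(3) h0(2) by (meson mult_left_mono order_trans)
    finally have "S (b - a) x \<in> cball x r" by (simp add: dist_norm norm_minus_commute)
    then have "norm (S a (S (b - a) x) - S a x) \<le> L * norm (S (b - a) x - x)" by (intro L that)
    also have "\<dots> \<le> L * (C * (b - a))" using n r(2) by (rule mult_left_mono)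
    also have "\<dots> \<le> B * (b - a)" unfolding mult.assoc[symmetric]
      using that by (intro mult_right_mono) (auto simp: B_def)
    finally show ?thesis using S_add[of "b - a" a x] that by simp
  next
    case False
    have "0 \<le> K" using K[OF that(1)] norm_ge_zero order_trans by blast
    have "norm (S b x - S a x) \<le> 2 * K"
      using K[OF that(1)] K[OF that(2)] norm_triangle_ineq4[of "S b x" "S a x"] by simp
    also have "\<dots> = 2 * K / h1 * h1" using h1(1) by simp
    also have "\<dots> \<le> 2 * K / h1 * (b - a)" using False \<open>0 \<le> K\<close> h1(1) by (intro mult_left_mono) auto
    also have "\<dots> \<le> B * (b - a)" using that by (intro mult_right_mono) (auto simp: B_def)
    finally show ?thesis .
  qed
  have "norm (S b x - S a x) \<le> B * \<bar>b - a\<bar>" if "a \<in> {0..T}" "b \<in> {0..T}" for a b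
    using le[OF that] le[OF that(2,1)] by (cases "a \<le> b") (auto simp: norm_minus_commute)
  then show ?thesis by blast
qed

lemma functional_bounded_linear: "\<mu> \<in> functionals_M j \<Longrightarrow> bounded_linear \<mu>"
  by (intro positive_functional_bounded_linear) (auto simp: functionals_M_def)

lemma functional_orbit_locally_lipschitz:
  assumes x: "x \<in> lipschitz_set S" and \<mu>: "\<mu> \<in> functionals_M j"
  shows "locally_lipschitz (\<lambda>t. \<mu> (S t x))"
  unfolding locally_lipschitz_def
proof (intro allI impI)
  interpret \<mu>: bounded_linear \<mu> using \<mu> by (rule functional_bounded_linear)
  obtain K where K: "0 < K" "\<And>y. norm (\<mu> y) \<le> norm y * K" using \<mu>.pos_bounded by blast
  fix T :: real
  obtain L where L: "\<And>a b. a \<in> {0..T} \<Longrightarrow> b \<in> {0..T} \<Longrightarrow> norm (S b x - S a x) \<le> L * \<bar>b - a\<bar>"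
    using orbit_lipschitz[OF x] by blast
  have "\<bar>\<mu> (S b x) - \<mu> (S a x)\<bar> \<le> L * K * \<bar>b - a\<bar>" if "a \<in> {0..T}" "b \<in> {0..T}" for a b
  proof -
    have "\<bar>\<mu> (S b x) - \<mu> (S a x)\<bar> \<le> norm (S b x - S a x) * K"
      using K(2)[of "S b x - S a x"] by (simp add: \<mu>.diff)
    also have "\<dots> \<le> L * \<bar>b - a\<bar> * K" using L[OF that] K(1) by (intro mult_right_mono) auto
    finally show ?thesis by (simp add: mult_ac)
  qed
  then show "\<exists>L. \<forall>a\<in>{0..T}. \<forall>b\<in>{0..T}. \<bar>\<mu> (S b x) - \<mu> (S a x)\<bar> \<le> L * \<bar>b - a\<bar>" by blast
qed

lemma density_exists:
  assumes x: "x \<in> lipschitz_set S" and \<mu>: "\<mu> \<in> functionals_M j"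
  shows "\<exists>f. is_density S \<mu> x f"
proof -
  obtain f where f: "f \<in> borel_measurable borel" "\<forall>t\<ge>0. bounded (f ` {0..t})"
    "\<forall>t\<ge>0. \<mu> (S t x) = \<mu> (S 0 x) + (LBINT s:{0..t}. f s)"
    using locally_lipschitz_density[OF functional_orbit_locally_lipschitz[OF assms]] by blast
  then have "is_density S \<mu> x f"
    unfolding is_density_def set_borel_measurable_def by (auto simp: S_0)
  then show ?thesis by blast
qed

section \<open>Uniqueness of the monotone generator\<close>

lemma null_sequence_at_right: "null_sequence h \<Longrightarrow> filterlim h (at_right 0) sequentially"
  by (auto simp: null_sequence_def real_decreases_to_def intro!: tendsto_imp_filterlim_at_right)

lemma null_sequence_harmonic: "null_sequence (\<lambda>n. 1 / real (Suc n))"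
  using LIMSEQ_inverse_real_of_nat
  by (auto simp: null_sequence_def real_decreases_to_def decseq_def inverse_eq_divide field_simps)

lemma monotone_limit_alongI:
  assumes "(\<lambda>n. norm (difference_quotient S x (h n) - a n)) \<longlonglongrightarrow> 0" "decreases_to j (\<lambda>n. j (a n)) y"
  shows "monotone_limit_along j S x h y"
  unfolding monotone_limit_along_def
  using assms decreases_to_X_deltaI[OF assms(2)] by (intro conjI exI[of _ a])

text \<open>Norm continuity of mu removes the approximation error, and continuity from above handles
  the decreasing part.\<close>

lemma limit_along_functional:
  assumes "monotone_limit_along j S x h y" "\<mu> \<in> functionals_M j"
  shows "(\<lambda>n. \<mu> (difference_quotient S x (h n))) \<longlonglongrightarrow> functional_ext j \<mu> y"
proof -
  interpret \<mu>: bounded_linear \<mu> using assms(2) by (rule functional_bounded_linear)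
  obtain a where a: "(\<lambda>n. norm (difference_quotient S x (h n) - a n)) \<longlonglongrightarrow> 0"
    "decreases_to j (\<lambda>n. j (a n)) y"
    using assms(1) by (auto simp: monotone_limit_along_def)
  have "(\<lambda>n. \<mu> (difference_quotient S x (h n) - a n)) \<longlonglongrightarrow> 0"
    using a(1) by (intro \<mu>.tendsto_zero) (simp add: tendsto_norm_zero_iff)
  from tendsto_add[OF this functional_ext_tendsto[OF assms(2) a(2)]]
  show ?thesis by (simp add: \<mu>.diff)
qed

text \<open>The merged sequence must itself be decreasing, so indices are chosen recursively, far
  enough out to fall below the previous value. The index maps need only tend to infinity.\<close>

lemma interlace_null_sequences:
  assumes h: "null_sequence h" and h': "null_sequence h'"
  obtains k p q where "null_sequence k" "filterlim p at_top sequentially" "filterlim q at_top sequentially"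
    "\<And>i. k (2 * i) = h (p i)" "\<And>i. k (Suc (2 * i)) = h' (q i)"
proof -
  define H where "H n = (if even n then h else h')" for n :: nat
  have H: "null_sequence (H n)" for n using h h' by (simp add: H_def)
  have "\<exists>m. \<forall>n::nat. n \<le> m n \<and> H (Suc n) (m (Suc n)) \<le> H n (m n)"
  proof (rule dependent_nat_choice)
    show "\<exists>m::nat. 0 \<le> m" by simp
    fix m n :: nat
    have "H (Suc n) \<longlonglongrightarrow> 0" "0 < H n m" using H by (simp_all add: null_sequence_def real_decreases_to_def)
    then have "\<forall>\<^sub>F i in sequentially. H (Suc n) i < H n m" by (rule order_tendstoD)
    then have "\<forall>\<^sub>F i in sequentially. Suc n \<le> i \<and> H (Suc n) i \<le> H n m"
      using eventually_ge_at_top[of "Suc n"] by eventually_elim auto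
    then show "\<exists>i. Suc n \<le> i \<and> H (Suc n) i \<le> H n m"
      using eventually_happens by fastforce
  qed
  then obtain m where m: "\<And>n. n \<le> m n" "\<And>n. H (Suc n) (m (Suc n)) \<le> H n (m n)" by blast
  define k where "k n = H n (m n)" for n
  have k_pos: "0 < k n" for n using H by (simp add: k_def null_sequence_def)
  \<comment> \<open>\<open>n \<le> m n\<close> puts \<open>k n\<close> below the n-th term of h or
    of h'; the sum covers both parities.\<close>
  have k_le: "k n \<le> h n + h' n" for n
  proof -
    have "k n \<le> H n n" using H[of n] m(1)[of n]
      by (simp add: k_def null_sequence_def real_decreases_to_def decseq_def)
    also have "\<dots> \<le> h n + h' n" using h h' by (simp add: H_def null_sequence_def less_imp_le)
    finally show ?thesis .
  qed
  have "(\<lambda>n. h n + h' n) \<longlonglongrightarrow> 0 + 0"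
    using h h' by (intro tendsto_add) (simp_all add: null_sequence_def real_decreases_to_def)
  then have "k \<longlonglongrightarrow> 0"
    using k_pos k_le by (intro tendsto_sandwich[of "\<lambda>_. 0" k sequentially "\<lambda>n. h n + h' n"]) (auto simp: less_imp_le)
  then have "null_sequence k"
    using k_pos m(2) by (simp add: null_sequence_def real_decreases_to_def decseq_SucI k_def)
  moreover have "filterlim (\<lambda>i. m (2 * i)) at_top sequentially" "filterlim (\<lambda>i. m (Suc (2 * i))) at_top sequentially"
  proof -
    have "i \<le> m (2 * i)" "i \<le> m (Suc (2 * i))" for i
      using m(1)[of "2 * i"] m(1)[of "Suc (2 * i)"] by linarith+
    then show "filterlim (\<lambda>i. m (2 * i)) at_top sequentially" "filterlim (\<lambda>i. m (Suc (2 * i))) at_top sequentially"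
      by (auto intro!: filterlim_at_top_mono[OF filterlim_ident] always_eventually)
  qed
  ultimately show ?thesis
    using that[of k "\<lambda>i. m (2 * i)" "\<lambda>i. m (Suc (2 * i))"] by (simp add: k_def H_def)
qed

lemma separates_points:
  assumes "x \<in> X_delta j" "y \<in> X_delta j"
    and "\<And>\<mu>. \<mu> \<in> functionals_M j \<Longrightarrow> functional_ext j \<mu> x = functional_ext j \<mu> y"
  shows "x = y"
  using separates assms unfolding M_separates_points_def by blast

text \<open>Membership in the domain gives a limit z along the interlaced sequence. Its even and odd
  subsequences show that every mu in M takes the same value at y, z and y'.\<close>

lemma monotone_limit_along_unique:
  assumes x: "x \<in> monotone_generator_domain j S"
    and h: "null_sequence h" "monotone_limit_along j S x h y"
    and h': "null_sequence h'" "monotone_limit_along j S x h' y'"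
  shows "y = y'"
proof (rule separates_points)
  show "y \<in> X_delta j" "y' \<in> X_delta j" using h(2) h'(2) by (auto simp: monotone_limit_along_def)
  fix \<mu> assume \<mu>: "\<mu> \<in> functionals_M j"
  obtain k p q where k: "null_sequence k" and pq: "filterlim p at_top sequentially" "filterlim q at_top sequentially"
    and k_eq: "\<And>i. k (2 * i) = h (p i)" "\<And>i. k (Suc (2 * i)) = h' (q i)"
    using interlace_null_sequences[OF h(1) h'(1)] by metis
  obtain z where z: "monotone_limit_along j S x k z"
    using x k by (auto simp: monotone_generator_domain_def)
  note lim_k = limit_along_functional[OF z \<mu>]
  have "(\<lambda>i. \<mu> (difference_quotient S x (k (2 * i)))) \<longlonglongrightarrow> functional_ext j \<mu> z"
    by (rule LIMSEQ_subseq_LIMSEQ[OF lim_k, of "\<lambda>i. 2 * i", unfolded o_def]) (simp add: strict_mono_def)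
  moreover have "(\<lambda>i. \<mu> (difference_quotient S x (k (2 * i)))) \<longlonglongrightarrow> functional_ext j \<mu> y"
    unfolding k_eq using filterlim_compose[OF limit_along_functional[OF h(2) \<mu>] pq(1)] .
  ultimately have y: "functional_ext j \<mu> y = functional_ext j \<mu> z" using LIMSEQ_unique by blast
  have "(\<lambda>i. \<mu> (difference_quotient S x (k (Suc (2 * i))))) \<longlonglongrightarrow> functional_ext j \<mu> z"
    by (rule LIMSEQ_subseq_LIMSEQ[OF lim_k, of "\<lambda>i. Suc (2 * i)", unfolded o_def]) (simp add: strict_mono_def)
  moreover have "(\<lambda>i. \<mu> (difference_quotient S x (k (Suc (2 * i))))) \<longlonglongrightarrow> functional_ext j \<mu> y'"
    unfolding k_eq using filterlim_compose[OF limit_along_functional[OF h'(2) \<mu>] pq(2)] .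
  ultimately have "functional_ext j \<mu> y' = functional_ext j \<mu> z" using LIMSEQ_unique by blast
  with y show "functional_ext j \<mu> y = functional_ext j \<mu> y'" by simp
qed

lemma monotone_generator_limit:
  assumes x: "x \<in> monotone_generator_domain j S" and h: "null_sequence h"
  shows "monotone_limit_along j S x h (monotone_generator j S x)"
proof -
  obtain y where y: "monotone_limit_along j S x h y"
    using assms by (auto simp: monotone_generator_domain_def)
  have "monotone_limit_along j S x h' y" if h': "null_sequence h'" for h'
  proof -
    obtain y' where "monotone_limit_along j S x h' y'"
      using x h' by (auto simp: monotone_generator_domain_def)
    then show ?thesis using monotone_limit_along_unique[OF x h y h'] by blast
  qed
  moreover have "z = y" if "\<forall>h'. null_sequence h' \<longrightarrow> monotone_limit_along j S x h' z" for z
    using monotone_limit_along_unique[OF x h _ h y] that h by blast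
  ultimately have "monotone_generator j S x = y"
    unfolding monotone_generator_def by (intro the_equality) blast+
  then show ?thesis using y by simp
qed

lemma monotone_generatorI:
  assumes "\<And>h. null_sequence h \<Longrightarrow> monotone_limit_along j S x h y"
  shows "x \<in> monotone_generator_domain j S" "monotone_generator j S x = y"
proof -
  show x: "x \<in> monotone_generator_domain j S"
    using assms by (auto simp: monotone_generator_domain_def)
  show "monotone_generator j S x = y"
    using monotone_limit_along_unique[OF x null_sequence_harmonic monotone_generator_limit[OF x]
        null_sequence_harmonic assms] null_sequence_harmonic by blast
qed

lemma generator_domain_limit:
  assumes "(difference_quotient S x \<longlongrightarrow> y) (at_right 0)" "null_sequence h"
  shows "monotone_limit_along j S x h (j y)"
proof -
  have "(\<lambda>n. difference_quotient S x (h n)) \<longlonglongrightarrow> y"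
    using filterlim_compose[OF assms(1) null_sequence_at_right[OF assms(2)]] .
  then have "(\<lambda>n. norm (difference_quotient S x (h n) - y)) \<longlonglongrightarrow> 0"
    by (simp add: LIM_zero tendsto_norm_zero)
  from this decreases_to_const show ?thesis by (rule monotone_limit_alongI)
qed

lemma generator_domain_lipschitz_set:
  assumes "x \<in> generator_domain S"
  shows "x \<in> lipschitz_set S"
proof -
  obtain y where "(difference_quotient S x \<longlongrightarrow> y) (at_right 0)"
    using assms by (auto simp: generator_domain_def)
  then have "((\<lambda>h. norm (difference_quotient S x h)) \<longlongrightarrow> norm y) (at_right 0)" by (rule tendsto_norm)
  then have "\<forall>\<^sub>F h in at_right 0. norm (difference_quotient S x h) < norm y + 1"
    by (rule order_tendstoD) simp
  then obtain b where b: "0 < b" "\<And>h. 0 < h \<Longrightarrow> h < b \<Longrightarrow> norm (difference_quotient S x h) < norm y + 1"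
    unfolding eventually_at_right_field by auto
  have "bounded (difference_quotient S x ` {0<..b / 2})"
    using b by (auto simp: bounded_iff intro!: exI[of _ "norm y + 1"] less_imp_le)
  then show ?thesis using b(1) half_gt_zero unfolding lipschitz_set_def by blast
qed

text \<open>Quotients exceeding every n could be arranged along a null sequence. The approximating
  sequence there lies between a lower bound in X and its first term, hence is norm bounded, and so
  are the quotients.\<close>

lemma monotone_generator_domain_lipschitz_set:
  assumes x: "x \<in> monotone_generator_domain j S"
  shows "x \<in> lipschitz_set S"
proof (rule ccontr)
  assume "x \<notin> lipschitz_set S"
  then have unb: "\<exists>h\<in>{0<..h0}. C < norm (difference_quotient S x h)" if "0 < h0" for h0 C
    using that by (force simp: lipschitz_set_def bounded_iff not_le)
  have "\<exists>h. \<forall>n. (0 < h n \<and> h n \<le> 1 / real (Suc n) \<and> real n < norm (difference_quotient S x (h n)))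
      \<and> h (Suc n) \<le> h n"
  proof (rule dependent_nat_choice)
    show "\<exists>h>0. h \<le> 1 / real (Suc 0) \<and> real 0 < norm (difference_quotient S x h)"
      using unb[of 1 0] by auto
    fix h n assume "0 < h \<and> h \<le> 1 / real (Suc n) \<and> real n < norm (difference_quotient S x h)"
    then have "0 < min h (1 / real (Suc (Suc n)))" by simp
    from unb[OF this, of "real (Suc n)"]
    show "\<exists>k. (0 < k \<and> k \<le> 1 / real (Suc (Suc n)) \<and> real (Suc n) < norm (difference_quotient S x k)) \<and> k \<le> h"
      by (auto simp del: of_nat_Suc)
  qed
  then obtain h where h: "\<And>n. 0 < h n" "\<And>n. h n \<le> 1 / real (Suc n)"
    "\<And>n. real n < norm (difference_quotient S x (h n))" "\<And>n. h (Suc n) \<le> h n" by blast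
  have "h \<longlonglongrightarrow> 0"
    using null_sequence_harmonic h(1)[THEN less_imp_le] h(2)
    by (intro tendsto_sandwich[of "\<lambda>_. 0" h sequentially "\<lambda>n. 1 / real (Suc n)"])
      (auto simp: null_sequence_def real_decreases_to_def)
  then have "null_sequence h" using h by (simp add: null_sequence_def real_decreases_to_def decseq_SucI)
  then obtain a y where a: "(\<lambda>n. norm (difference_quotient S x (h n) - a n)) \<longlonglongrightarrow> 0"
    "decreases_to j (\<lambda>n. j (a n)) y"
    using x unfolding monotone_generator_domain_def monotone_limit_along_def by blast
  obtain l where l: "\<And>n. l \<le> a n" using a(2) by (auto simp: decreases_to_iff j_le_iff)
  have "a n \<le> a 0" for n using a(2) by (simp add: decreases_to_iff decseq_def j_le_iff)
  then have a_le: "norm (a n) \<le> norm l + norm (a 0)" for n by (intro norm_between l)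
  have "bounded (range (\<lambda>n. norm (difference_quotient S x (h n) - a n)))"
    using a(1) by (rule convergent_imp_bounded)
  then obtain B where B: "\<And>n. norm (difference_quotient S x (h n) - a n) \<le> B" by (auto simp: bounded_iff)
  obtain n where n: "B + (norm l + norm (a 0)) \<le> real n" using real_arch_simple by blast
  have "norm (difference_quotient S x (h n)) \<le> norm (difference_quotient S x (h n) - a n) + norm (a n)"
    by (rule norm_triangle_sub[of "difference_quotient S x (h n)" "a n", unfolded add.commute[of "norm (a n)"]])
  also have "\<dots> \<le> real n" using B[of n] a_le[of n] n by linarith
  finally show False using h(3)[of n] by simp
qed

text \<open>A quotient in space: the slope of S(t) at x in direction y, whereas
  \<open>difference_quotient\<close> is taken in time.\<close>

definition orbit_quotient :: "real \<Rightarrow> 'a \<Rightarrow> real \<Rightarrow> 'a \<Rightarrow> 'a" where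
  "orbit_quotient t x h y = (S t (x + h *\<^sub>R y) - S t x) /\<^sub>R h"

lemma orbit_quotient_mono_step:
  assumes "0 \<le> t" "0 < h" "h \<le> k"
  shows "orbit_quotient t x h y \<le> orbit_quotient t x k y"
proof -
  have "S t (x + (h / k) *\<^sub>R (k *\<^sub>R y)) - S t x \<le> (h / k) *\<^sub>R (S t (x + k *\<^sub>R y) - S t x)"
    using assms by (intro convex_difference_le S_convex) auto
  then have "inverse h *\<^sub>R (S t (x + h *\<^sub>R y) - S t x) \<le> inverse h *\<^sub>R ((h / k) *\<^sub>R (S t (x + k *\<^sub>R y) - S t x))"
    using assms by (intro scaleR_left_mono) auto
  moreover have "inverse h * (h / k) = inverse k" using assms by (simp add: field_simps)
  ultimately show ?thesis unfolding orbit_quotient_def scaleR_scaleR by simp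
qed

text \<open>A lower bound in X that is free of h, as needed for the slopes to decrease to an element
  of \<open>X_delta j\<close>.\<close>

lemma orbit_quotient_ge:
  assumes "0 \<le> t" "0 < h"
  shows "S t x - S t (x - y) \<le> orbit_quotient t x h y"
  using convex_difference_ge[OF S_convex[OF assms(1)], of h x y] assms(2)
  unfolding orbit_quotient_def by (subst pos_le_divideR_eq) auto

text \<open>Links time and space: S(h)S(t)x = S(t)(x + hd) with d the time quotient at x. Replacing
  d by a changes the slope by at most L times the norm of d - a, once both points are close to
  x.\<close>

lemma orbit_quotient_approximation:
  assumes t: "0 \<le> t" and h: "null_sequence h"
    and a: "(\<lambda>n. norm (difference_quotient S x (h n) - a n)) \<longlonglongrightarrow> 0"
  shows "(\<lambda>n. norm (difference_quotient S (S t x) (h n) - orbit_quotient t x (h n) (a n))) \<longlonglongrightarrow> 0"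
proof -
  obtain L where L: "0 \<le> L"
    "\<And>y z. y \<in> cball x 1 \<Longrightarrow> z \<in> cball x 1 \<Longrightarrow> norm (S t y - S t z) \<le> L * norm (y - z)"
    using convex_bounded_locally_lipschitz[OF S_convex S_bounded, of t x] t by blast
  define d where "d n = difference_quotient S x (h n)" for n
  have h_pos: "0 < h n" for n using h by (simp add: null_sequence_def)
  have S_eq: "S (h n) x = x + h n *\<^sub>R d n" for n
    using h_pos[of n] by (simp add: d_def difference_quotient_def)
  have "h \<longlonglongrightarrow> 0" using h by (simp add: null_sequence_def real_decreases_to_def)
  have "(\<lambda>n. S (h n) x) \<longlonglongrightarrow> x"
    using filterlim_compose[OF S_tendsto null_sequence_at_right[OF h]] .
  then have hd: "(\<lambda>n. h n *\<^sub>R d n) \<longlonglongrightarrow> 0"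
    unfolding S_eq using tendsto_diff[of "\<lambda>n. x + h n *\<^sub>R d n" x sequentially "\<lambda>_. x" x] by simp
  have da: "(\<lambda>n. d n - a n) \<longlonglongrightarrow> 0" using a by (simp add: d_def tendsto_norm_zero_iff)
  \<comment> \<open>No bound on \<open>a\<close> is assumed; that \<open>h n\<close> times
    \<open>a n\<close> vanishes follows from strong continuity, which makes \<open>h n\<close> times
    \<open>d n\<close> vanish.\<close>
  have "(\<lambda>n. h n *\<^sub>R d n - h n *\<^sub>R (d n - a n)) \<longlonglongrightarrow> 0 - 0 *\<^sub>R 0"
    by (intro tendsto_diff tendsto_scaleR hd da \<open>h \<longlonglongrightarrow> 0\<close>)
  then have ha: "(\<lambda>n. h n *\<^sub>R a n) \<longlonglongrightarrow> 0" by (simp add: scaleR_diff_right)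
  have near: "\<forall>\<^sub>F n in sequentially. x + u n \<in> cball x 1" if "u \<longlonglongrightarrow> 0" for u :: "nat \<Rightarrow> 'a"
  proof -
    have "\<forall>\<^sub>F n in sequentially. dist (u n) 0 < 1" using that by (rule tendstoD) simp
    then show ?thesis by eventually_elim (simp add: dist_norm)
  qed
  show ?thesis
  proof (rule tendsto_norm_zero, rule Lim_null_comparison)
    show "\<forall>\<^sub>F n in sequentially. norm (difference_quotient S (S t x) (h n) - orbit_quotient t x (h n) (a n))
        \<le> L * norm (d n - a n)"
      using near[OF hd] near[OF ha]
    proof eventually_elim
      case (elim n)
      have "norm (S t (x + h n *\<^sub>R d n) - S t (x + h n *\<^sub>R a n))
          \<le> L * norm ((x + h n *\<^sub>R d n) - (x + h n *\<^sub>R a n))"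
        using elim by (intro L)
      also have "(x + h n *\<^sub>R d n) - (x + h n *\<^sub>R a n) = h n *\<^sub>R (d n - a n)" by (simp add: algebra_simps)
      also have "L * norm (h n *\<^sub>R (d n - a n)) = L * norm (d n - a n) * h n"
        using h_pos[of n] by simp
      finally have le: "norm (S t (x + h n *\<^sub>R d n) - S t (x + h n *\<^sub>R a n)) / h n \<le> L * norm (d n - a n)"
        using h_pos[of n] by (simp add: pos_divide_le_eq)
      have "S (h n) (S t x) = S t (x + h n *\<^sub>R d n)"
        using S_add[of "h n" t x] S_add[of t "h n" x] h_pos[of n] t by (simp add: add.commute S_eq)
      then have "difference_quotient S (S t x) (h n) - orbit_quotient t x (h n) (a n)
          = (S t (x + h n *\<^sub>R d n) - S t (x + h n *\<^sub>R a n)) /\<^sub>R h n"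
        by (simp add: difference_quotient_def orbit_quotient_def flip: scaleR_diff_right)
      then have "norm (difference_quotient S (S t x) (h n) - orbit_quotient t x (h n) (a n))
          = norm (S t (x + h n *\<^sub>R d n) - S t (x + h n *\<^sub>R a n)) / h n"
        using h_pos[of n] by (simp only: norm_scaleR) (simp add: divide_inverse mult.commute)
      then show ?case using le by simp
    qed
    show "(\<lambda>n. L * norm (d n - a n)) \<longlonglongrightarrow> 0"
      using tendsto_mult_right_zero[OF tendsto_norm_zero[OF da]] .
  qed
qed

lemma null_sequence_le: "null_sequence h \<Longrightarrow> 0 < e \<Longrightarrow> \<exists>n\<ge>m. h n \<le> e"
proof -
  assume "null_sequence h" "0 < e"
  then have "\<forall>\<^sub>F n in sequentially. h n < e"
    by (auto simp: null_sequence_def real_decreases_to_def dest: order_tendstoD)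
  then have "\<forall>\<^sub>F n in sequentially. m \<le> n \<and> h n \<le> e"
    using eventually_ge_at_top[of m] by eventually_elim auto
  then show ?thesis using eventually_happens by fastforce
qed

lemma directional_derivative_eqI:
  fixes T :: "'b \<Rightarrow> 'b"
  assumes "\<And>h. 0 < h \<Longrightarrow> z \<le> (T (x + h *\<^sub>R y) - T x) /\<^sub>R h"
    and "\<And>w. (\<And>h. 0 < h \<Longrightarrow> w \<le> (T (x + h *\<^sub>R y) - T x) /\<^sub>R h) \<Longrightarrow> w \<le> z"
  shows "directional_derivative T x y = z"
proof -
  have "isGlb UNIV ((\<lambda>h. (T (x + h *\<^sub>R y) - T x) /\<^sub>R h) ` {0<..}) z"
    unfolding isGlb_UNIV_iff using assms by auto
  then show ?thesis
    unfolding directional_derivative_def using isGlb_UNIV_unique by (intro the_equality)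
qed

lemma transported_embedding: "transported j T (j x) = j (T x)"
  using emb by (simp add: transported_def riesz_embedding_def)

text \<open>Slopes decrease with the step, so the infimum along one null sequence is already the
  infimum over all positive steps.\<close>

lemma decreases_to_directional_derivative:
  assumes t: "0 \<le> t" and h: "null_sequence h"
  shows "decreases_to j (\<lambda>n. j (orbit_quotient t x (h n) y))
    (directional_derivative (transported j (S t)) (j x) (j y))"
proof -
  have h_pos: "0 < h n" for n using h by (simp add: null_sequence_def)
  have "decseq (\<lambda>n. orbit_quotient t x (h n) y)"
    using h h_pos unfolding decseq_def null_sequence_def real_decreases_to_def
    by (auto intro: orbit_quotient_mono_step[OF t])
  then obtain z where z: "decreases_to j (\<lambda>n. j (orbit_quotient t x (h n) y)) z"
    using decreases_to_exists orbit_quotient_ge[OF t h_pos] by blast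
  have q: "(transported j (S t) (j x + e *\<^sub>R j y) - transported j (S t) (j x)) /\<^sub>R e
      = j (orbit_quotient t x e y)" for e
    by (simp add: orbit_quotient_def transported_embedding flip: j_simps)
  have "directional_derivative (transported j (S t)) (j x) (j y) = z"
  proof (rule directional_derivative_eqI; unfold q)
    fix e :: real assume "0 < e"
    then obtain n where "h n \<le> e" using null_sequence_le[OF h] by blast
    then have "orbit_quotient t x (h n) y \<le> orbit_quotient t x e y"
      by (intro orbit_quotient_mono_step t h_pos)
    then show "z \<le> j (orbit_quotient t x e y)"
      using z unfolding decreases_to_iff by (meson j_le_iff order_trans)
  next
    fix w assume "\<And>e. 0 < e \<Longrightarrow> w \<le> j (orbit_quotient t x e y)"
    then show "w \<le> z" using z h_pos unfolding decreases_to_iff by blast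
  qed
  then show ?thesis using z by simp
qed

lemma orbit_generator_formula_generator_domain:
  assumes "x \<in> generator_domain S"
  shows "orbit_generator_formula j S (\<lambda>t. transported j (S t)) x"
  unfolding orbit_generator_formula_def
proof (intro allI impI)
  fix t :: real assume t: "0 \<le> t"
  obtain y where y: "(difference_quotient S x \<longlongrightarrow> y) (at_right 0)"
    using assms by (auto simp: generator_domain_def)
  have gen: "monotone_generator j S x = j y"
    using monotone_generatorI(2)[of x "j y"] generator_domain_limit[OF y] .
  let ?z = "directional_derivative (transported j (S t)) (j x) (j y)"
  have "monotone_limit_along j S (S t x) h ?z" if h: "null_sequence h" for h
  proof -
    have "(\<lambda>n. difference_quotient S x (h n)) \<longlonglongrightarrow> y"
      using filterlim_compose[OF y null_sequence_at_right[OF h]] .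
    then have "(\<lambda>n. norm (difference_quotient S x (h n) - y)) \<longlonglongrightarrow> 0"
      by (simp add: LIM_zero tendsto_norm_zero)
    from orbit_quotient_approximation[OF t h this] decreases_to_directional_derivative[OF t h]
    show ?thesis by (rule monotone_limit_alongI)
  qed
  from monotone_generatorI[OF this]
  show "S t x \<in> monotone_generator_domain j S \<and>
      monotone_generator j S (S t x) = directional_derivative (transported j (S t)) (j x) (monotone_generator j S x)"
    unfolding gen by blast
qed

section \<open>Directions in the extended space, for monotone semigroups continuous from
  above\<close>

context
  assumes mono: "monotone_semigroup S" and above: "continuous_from_above j S"
begin

lemma S_mono: "0 \<le> t \<Longrightarrow> mono (S t)"
  using mono by (simp add: monotone_semigroup_def)

lemma S_above_zero:
  "0 \<le> t \<Longrightarrow> decreases_to j (\<lambda>n. j (x n)) 0 \<Longrightarrow> decreases_to j (\<lambda>n. j (S t (x n))) (j (S t 0))"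
  using above by (simp add: continuous_from_above_def)

lemma orbit_quotient_mono:
  assumes "0 \<le> t" "0 < h" "y \<le> z"
  shows "orbit_quotient t x h y \<le> orbit_quotient t x h z"
proof -
  have "x + h *\<^sub>R y \<le> x + h *\<^sub>R z" using assms by (intro add_left_mono scaleR_left_mono) auto
  then have "S t (x + h *\<^sub>R y) \<le> S t (x + h *\<^sub>R z)" by (rule monoD[OF S_mono[OF assms(1)]])
  then show ?thesis
    unfolding orbit_quotient_def using assms by (intro scaleR_left_mono diff_right_mono) auto
qed

text \<open>Step and direction shrink together. Joint monotonicity makes this diagonal infimum equal
  to the iterated one: first over directions, which gives the extension of S(t), then over
  steps.\<close>

lemma decreases_to_directional_derivative_ext:
  assumes t: "0 \<le> t" and h: "null_sequence h" and a: "decreases_to j (\<lambda>n. j (a n)) y"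
  shows "decreases_to j (\<lambda>n. j (orbit_quotient t x (h n) (a n)))
    (directional_derivative (operator_ext j (S t)) (j x) y)"
proof -
  let ?U = "operator_ext j (S t)"
  note ext = S_convex[OF t] S_mono[OF t] S_above_zero[OF t]
  have h_pos: "0 < h n" for n using h by (simp add: null_sequence_def)
  have h_dec: "h n \<le> h m" if "m \<le> n" for m n
    using h that by (simp add: null_sequence_def real_decreases_to_def decseq_def)
  have a_dec: "a n \<le> a m" if "m \<le> n" for m n
    using a that by (simp add: decreases_to_iff decseq_def j_le_iff)
  obtain l where l: "\<And>n. l \<le> a n" using a by (auto simp: decreases_to_iff j_le_iff)
  have "decseq (\<lambda>n. orbit_quotient t x (h n) (a n))"
    unfolding decseq_def
  proof (intro allI impI)
    fix m n :: nat assume mn: "m \<le> n"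
    have "orbit_quotient t x (h n) (a n) \<le> orbit_quotient t x (h n) (a m)"
      by (intro orbit_quotient_mono t h_pos a_dec mn)
    also have "\<dots> \<le> orbit_quotient t x (h m) (a m)"
      by (intro orbit_quotient_mono_step t h_pos h_dec mn)
    finally show "orbit_quotient t x (h n) (a n) \<le> orbit_quotient t x (h m) (a m)" .
  qed
  moreover have "S t x - S t (x - l) \<le> orbit_quotient t x (h n) (a n)" for n
    using orbit_quotient_ge[OF t h_pos] orbit_quotient_mono[OF t h_pos l] by (rule order_trans)
  ultimately obtain z where z: "decreases_to j (\<lambda>n. j (orbit_quotient t x (h n) (a n))) z"
    using decreases_to_exists by blast
  have U: "decreases_to j (\<lambda>n. j (S t (x + e *\<^sub>R a n))) (?U (j x + e *\<^sub>R y))" if "0 \<le> e" for e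
  proof (rule operator_ext_decreases_to[OF ext])
    show "decreases_to j (\<lambda>n. j (x + e *\<^sub>R a n)) (j x + e *\<^sub>R y)"
      using decreases_to_add[OF decreases_to_const decreases_to_scaleR[OF a that]] by (simp add: j_simps)
  qed
  have Ux: "?U (j x) = j (S t x)" by (rule operator_ext_embedding[OF ext])
  have "directional_derivative ?U (j x) y = z"
  proof (rule directional_derivative_eqI; unfold Ux)
    fix e :: real assume e: "0 < e"
    \<comment> \<open>With e and m fixed, a late diagonal term has a smaller step and a smaller
      direction; m may then run to infinity, which turns S(t) into its extension.\<close>
    have "e *\<^sub>R z + j (S t x) \<le> j (S t (x + e *\<^sub>R a m))" for m
    proof -
      obtain n where n: "m \<le> n" "h n \<le> e" using null_sequence_le[OF h e] by blast
      have "orbit_quotient t x (h n) (a n) \<le> orbit_quotient t x e (a n)"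
        by (intro orbit_quotient_mono_step t h_pos n)
      also have "\<dots> \<le> orbit_quotient t x e (a m)" by (intro orbit_quotient_mono t e a_dec n)
      finally have "z \<le> j (orbit_quotient t x e (a m))"
        using z unfolding decreases_to_iff by (meson j_le_iff order_trans)
      then have "z \<le> (j (S t (x + e *\<^sub>R a m)) - j (S t x)) /\<^sub>R e"
        by (simp only: orbit_quotient_def j_simps)
      then have "e *\<^sub>R z \<le> j (S t (x + e *\<^sub>R a m)) - j (S t x)" by (simp only: pos_le_divideR_eq[OF e])
      then show ?thesis by (simp only: le_diff_eq)
    qed
    then have "e *\<^sub>R z + j (S t x) \<le> ?U (j x + e *\<^sub>R y)"
      using U[of e] e unfolding decreases_to_iff by (meson less_imp_le)
    then show "z \<le> (?U (j x + e *\<^sub>R y) - j (S t x)) /\<^sub>R e"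
      by (simp only: pos_le_divideR_eq[OF e] le_diff_eq)
  next
    fix w assume w: "\<And>e. 0 < e \<Longrightarrow> w \<le> (?U (j x + e *\<^sub>R y) - j (S t x)) /\<^sub>R e"
    \<comment> \<open>Conversely, the extension at direction y lies below S(t) at direction
      \<open>a n\<close>, so the step \<open>h n\<close> alone suffices.\<close>
    have "w \<le> j (orbit_quotient t x (h n) (a n))" for n
    proof -
      have "?U (j x + h n *\<^sub>R y) \<le> j (S t (x + h n *\<^sub>R a n))"
        using U[of "h n"] h_pos[of n] unfolding decreases_to_iff by (meson less_imp_le)
      then have "(?U (j x + h n *\<^sub>R y) - j (S t x)) /\<^sub>R h n \<le> (j (S t (x + h n *\<^sub>R a n)) - j (S t x)) /\<^sub>R h n"
        using h_pos[of n] by (intro scaleR_left_mono diff_right_mono) auto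
      also have "\<dots> = j (orbit_quotient t x (h n) (a n))" by (simp only: orbit_quotient_def j_simps)
      finally show ?thesis using w[OF h_pos[of n]] by order
    qed
    then show "w \<le> z" using z unfolding decreases_to_iff by blast
  qed
  then show ?thesis using z by simp
qed

lemma orbit_generator_formula_monotone_generator_domain:
  assumes x: "x \<in> monotone_generator_domain j S"
  shows "orbit_generator_formula j S (\<lambda>t. operator_ext j (S t)) x"
  unfolding orbit_generator_formula_def
proof (intro allI impI)
  fix t :: real assume t: "0 \<le> t"
  let ?z = "directional_derivative (operator_ext j (S t)) (j x) (monotone_generator j S x)"
  have "monotone_limit_along j S (S t x) h ?z" if h: "null_sequence h" for h
  proof -
    obtain a where a: "(\<lambda>n. norm (difference_quotient S x (h n) - a n)) \<longlonglongrightarrow> 0"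
      "decreases_to j (\<lambda>n. j (a n)) (monotone_generator j S x)"
      using monotone_generator_limit[OF x h] by (auto simp: monotone_limit_along_def)
    from orbit_quotient_approximation[OF t h a(1)] decreases_to_directional_derivative_ext[OF t h a(2)]
    show ?thesis by (rule monotone_limit_alongI)
  qed
  from monotone_generatorI[OF this]
  show "S t x \<in> monotone_generator_domain j S \<and> monotone_generator j S (S t x) = ?z" by blast
qed

end

lemma is_density_cong:
  assumes "is_density S \<mu> x f" and eq: "\<And>s. 0 \<le> s \<Longrightarrow> f s = g s"
  shows "is_density S \<mu> x g"
proof -
  have "(\<lambda>s. indicator {0..} s *\<^sub>R f s) = (\<lambda>s. indicator {0..} s *\<^sub>R g s)"
    using eq by (auto simp: indicator_def)
  moreover have "f ` {0..t} = g ` {0..t}" for t using eq by auto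
  moreover have "(LBINT s:{0..t}. f s) = (LBINT s:{0..t}. g s)" for t
    using eq by (intro set_lebesgue_integral_cong) auto
  ultimately show ?thesis using assms(1) unfolding is_density_def set_borel_measurable_def by simp
qed

text \<open>By the semigroup law, the right difference quotients of mu S(t)x are mu applied to the
  time quotients at S(t)x, whose limit is the monotone generator there.\<close>

lemma orbit_is_density:
  assumes x: "x \<in> lipschitz_set S" and \<mu>: "\<mu> \<in> functionals_M j"
    and dom: "\<And>t. 0 \<le> t \<Longrightarrow> S t x \<in> monotone_generator_domain j S"
  shows "is_density S \<mu> x (\<lambda>s. functional_ext j \<mu> (monotone_generator j S (S s x)))"
proof -
  interpret \<mu>: bounded_linear \<mu> using \<mu> by (rule functional_bounded_linear)
  let ?G = "\<lambda>s. functional_ext j \<mu> (monotone_generator j S (S s x))"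
  have lim: "(\<lambda>n. (\<mu> (S (t + 1 / real (Suc n)) x) - \<mu> (S t x)) * real (Suc n)) \<longlonglongrightarrow> ?G t" if t: "0 \<le> t" for t
  proof -
    have "\<mu> (difference_quotient S (S t x) (1 / real (Suc n)))
        = (\<mu> (S (t + 1 / real (Suc n)) x) - \<mu> (S t x)) * real (Suc n)" for n
      using S_add[of t "1 / real (Suc n)" x] t
      by (simp add: difference_quotient_def \<mu>.scaleR \<mu>.diff add.commute mult.commute del: of_nat_Suc)
    then show ?thesis
      using limit_along_functional[OF monotone_generator_limit[OF dom[OF t] null_sequence_harmonic] \<mu>] by simp
  qed
  note G = locally_lipschitz_right_derivative[OF functional_orbit_locally_lipschitz[OF x \<mu>] lim]
  show ?thesis using G unfolding is_density_def by (simp add: S_0)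
qed

lemma is_density_set_integrable: "is_density S \<mu> x f \<Longrightarrow> 0 \<le> t \<Longrightarrow> set_integrable lborel {0..t} f"
  by (intro set_integrable_bounded_interval) (auto simp: is_density_def)

lemma is_density_unique:
  assumes f: "is_density S \<mu> x f" and g: "is_density S \<mu> x g"
  shows "AE s in lborel. 0 \<le> s \<longrightarrow> f s = g s"
proof -
  have "AE s in lborel. s \<in> {0..real n} \<longrightarrow> f s = g s" for n
  proof (rule AE_eq_of_integrals_eq)
    show "set_integrable lborel {0..real n} f" "set_integrable lborel {0..real n} g"
      using is_density_set_integrable f g by auto
    show "(LBINT s:{0..t}. f s) = (LBINT s:{0..t}. g s)" if "0 \<le> t" for t
      using f g that by (simp add: is_density_def)
  qed
  then have "AE s in lborel. \<forall>n. s \<in> {0..real n} \<longrightarrow> f s = g s" unfolding AE_all_countable by blast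
  then show ?thesis
  proof (rule AE_mp, intro AE_I2 impI)
    fix s :: real assume "\<forall>n. s \<in> {0..real n} \<longrightarrow> f s = g s" "0 \<le> s"
    then show "f s = g s" using real_arch_simple[of s] by auto
  qed
qed

text \<open>The family \<open>E\<close> enters only through the generator formula, so the
  transported operators and the extensions are treated at once.\<close>

lemma orbit_integral_formulaI:
  assumes x: "x \<in> lipschitz_set S" and E: "orbit_generator_formula j S E x"
  shows "orbit_integral_formula j S E x"
  unfolding orbit_integral_formula_def Let_def
proof
  fix \<mu> assume \<mu>: "\<mu> \<in> functionals_M j"
  let ?g = "\<lambda>s. functional_ext j \<mu> (directional_derivative (E s) (j x) (monotone_generator j S x))"
  have "is_density S \<mu> x (\<lambda>s. functional_ext j \<mu> (monotone_generator j S (S s x)))"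
    using E by (intro orbit_is_density x \<mu>) (simp add: orbit_generator_formula_def)
  then have g: "is_density S \<mu> x ?g"
    by (rule is_density_cong) (use E in \<open>simp add: orbit_generator_formula_def\<close>)
  have "\<forall>t\<ge>0. set_integrable lborel {0..t} ?g \<and> \<mu> (S t x) = \<mu> x + (LBINT s:{0..t}. ?g s)"
    using g is_density_set_integrable[OF g] by (simp add: is_density_def)
  moreover have "\<forall>f. is_density S \<mu> x f \<longrightarrow> (AE s in lborel. 0 \<le> s \<longrightarrow> f s = ?g s)"
    using is_density_unique[OF _ g] by blast
  ultimately show "(\<forall>t\<ge>0. set_integrable lborel {0..t} ?g \<and> \<mu> (S t x) = \<mu> x + (LBINT s:{0..t}. ?g s)) \<and>
      (\<exists>f. is_density S \<mu> x f) \<and>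
      (\<forall>f. is_density S \<mu> x f \<longrightarrow> (AE s in lborel. 0 \<le> s \<longrightarrow> f s = ?g s))"
    using g by blast
qed

end

theorem theorem3p5:
  fixes j :: "'a::banach_lattice \<Rightarrow> 'b::dedekind_sigma_complete_riesz_space"
    and S :: "real \<Rightarrow> 'a \<Rightarrow> 'a"
  assumes "riesz_embedding j"
    and "M_separates_points j"
    and "C0_semigroup S"
    and "convex_semigroup S"
  shows "(\<forall>x\<in>lipschitz_set S.
        (\<forall>t\<ge>0. S t x \<in> lipschitz_set S) \<and>
        (\<forall>\<mu>\<in>functionals_M j. \<exists>f. is_density S \<mu> x f)) \<and>
    (\<forall>x\<in>generator_domain S.
        orbit_generator_formula j S (\<lambda>t. transported j (S t)) x \<and>
        orbit_integral_formula j S (\<lambda>t. transported j (S t)) x) \<and>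
    (monotone_semigroup S \<and> continuous_from_above j S \<longrightarrow>
      (\<forall>x\<in>monotone_generator_domain j S.
        orbit_generator_formula j S (\<lambda>t. operator_ext j (S t)) x \<and>
        orbit_integral_formula j S (\<lambda>t. operator_ext j (S t)) x))"
proof -
  interpret convex_C0_semigroup j S
    using assms by unfold_locales
  show ?thesis
    using lipschitz_set_invariant density_exists orbit_integral_formulaI
      orbit_generator_formula_generator_domain generator_domain_lipschitz_set
      orbit_generator_formula_monotone_generator_domain monotone_generator_domain_lipschitz_set
    by blast
qed

end
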